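(* Let $G$, $w$, $s$, $t$, $F_1,\dots,F_m$, $i\ge 2$, $X$, $\Omega$ and the links $L_{u,v}$ with lengths $\ell_{u,v}$ be as in the context. Let $x$ be a clean feasible solution of the linear program $$\min\Big\{\ell(x)\ :\ x_{u,v}\ge 0\ \text{ for all pairs } \{u,v\},\quad \sum_{\{u,v\}\in cover(F)}x_{u,v}\ge 1\ \text{ for all } F\in\Omega\Big\},$$ where $\ell(x)=\sum_{\{u,v\}}\ell_{u,v}x_{u,v}$. Then there exists a feasible set $S$ of links, i.e. a set of links such that every $F\in\Omega$ is covered by at least one link in $S$, with total cost $\sum_{L_{u,v}\in S}\ell_{u,v}\le 8i\,\ell(x)$.
   Context: Let $G=(V,E)$ be an undirected planar graph given with a planar embedding, let $w:E\to\mathbb{Z}_{\ge 0}$ be a weight function, let $s,t\in V$ be two nodes, and let $F_1,\dots,F_m\subseteq E$ be failure scenarios. Let $k=\max_j|F_j|$. For an integer $0\le r\le k$ let $$\Omega_r=\{F\subseteq E \mid F\subseteq F_j \text{ for some } j\in\{1,\dots,m\},\ |F|\le r\}.$$ Problem $\mathrm{P}_r$ is the problem in which a set $S'\subseteq E$ is feasible if $S'\setminus F$ contains an $s$-$t$ path for every $F\in\Omega_r$. Fix $i\in\{2,\dots,k\}$ and let $X\subseteq E$ be a feasible solution of $\mathrm{P}_{i-1}$. Let $\bar V$ be the set of nodes incident to $X$ and $\bar G=(\bar V,X)$. Let $\Omega$ denote the set of relevant scenarios, i.e. those $F\in\Omega_i$ such that $s$ and $t$ are disconnected in $(\bar V,X\setminus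 F)$; these are regarded as cuts of $\bar G$, i.e. as subsets of $X$ (of cardinality exactly $i$). Standing assumption: every edge of $X$ belongs to at least one scenario in $\Omega$ (edges not satisfying this are contracted beforehand). Under this assumption $(\bar V,X\setminus F)$ has, for each $F\in\Omega$, exactly two connected components, one containing $s$ and the other containing $t$; these are the two sides of the cut formed by $F$. Links: for distinct $u,v\in\bar V$ that are connected in $(V,E\setminus X)$, the link $L_{u,v}$ is a (fixed, arbitrarily chosen) shortest $u$-$v$ path with respect to $w$ in $(V,E\setminus X)$, and $\ell_{u,v}=w(L_{u,v})$ is its length. The variables $x_{u,v}$ are indexed by the unordered pairs $\{u,v\}$ for which a link exists. A link $L_{u,v}$ covers $F\in\Omega$ if $u$ and $v$ lie on different sides of the cut formed by $F$; $cover(F)$ is the set of pairs $\{u,v\}$ such that $L_{u,v}$ covers $F$. Typed links: let $\psi^1,\dots,\psi^{\bar q}$ be the faces of the embedding of $\bar G$ induced by the embedding of $G$. A link $L_{u,v}$ is of type $j$ if $u$ and $v$ are nodes on $\psi^j$ and $L_{u,v}$ is completely contained in the face $\psi^j$ (with its boundary). A link is typed if it is of type $j$ for some $j\in\{1,\dots,\bar q\}$, and untyped otherwise. A vector $x$ is clean if $x_{u,v}=0$ for every untyped link $L_{u,v}$. *)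

theory Defs
  imports "HOL-Analysis.Analysis"
begin

section \<open>Graphs and paths\<close>

text \<open>Parallel edges and loops are allowed, since they can arise when edges are contracted.\<close>

record ('v, 'e) mgraph =
  verts :: "'v set"
  edges :: "'e set"
  ends  :: "'e \<Rightarrow> 'v set"

definition multigraph :: "('v, 'e) mgraph \<Rightarrow> bool" where
  "multigraph G \<longleftrightarrow>
     finite (verts G) \<and> finite (edges G) \<and>
     (\<forall>e\<in>edges G. ends G e \<subseteq> verts G \<and> (card (ends G e) = 1 \<or> card (ends G e) = 2))"

text \<open>A path is identified with its set of edges, so it carries no orientation. The node sequence
  \<open>vs\<close> has no repetitions; \<open>P = {}\<close> is the trivial path.\<close>

definition is_path :: "('v, 'e) mgraph \<Rightarrow> 'e set \<Rightarrow> 'v \<Rightarrow> 'v \<Rightarrow> 'e set \<Rightarrow> bool" where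
  "is_path G A u v P \<longleftrightarrow>
     (\<exists>vs es. length vs = Suc (length es) \<and> distinct vs \<and> set vs \<subseteq> verts G \<and>
        hd vs = u \<and> last vs = v \<and>
        (\<forall>n<length es. ends G (es ! n) = {vs ! n, vs ! Suc n}) \<and>
        set es = P \<and> P \<subseteq> A)"

definition joined :: "('v, 'e) mgraph \<Rightarrow> 'e set \<Rightarrow> 'v \<Rightarrow> 'v \<Rightarrow> bool" where
  "joined G A u v \<longleftrightarrow> (\<exists>P. is_path G A u v P)"

definition is_shortest_path ::
  "('v, 'e) mgraph \<Rightarrow> ('e \<Rightarrow> nat) \<Rightarrow> 'e set \<Rightarrow> 'v \<Rightarrow> 'v \<Rightarrow> 'e set \<Rightarrow> bool" where
  "is_shortest_path G w A u v P \<longleftrightarrow>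
     is_path G A u v P \<and> (\<forall>Q. is_path G A u v Q \<longrightarrow> sum w P \<le> sum w Q)"


section \<open>Planar embeddings and faces\<close>

text \<open>Nodes are points of the plane and edges are simple curves (closed ones for loops); a curve
  meets nodes only at its ends, and two curves meet only in common end nodes.\<close>

definition planar_embedding ::
  "('v, 'e) mgraph \<Rightarrow> ('v \<Rightarrow> complex) \<Rightarrow> ('e \<Rightarrow> real \<Rightarrow> complex) \<Rightarrow> bool" where
  "planar_embedding G pos crv \<longleftrightarrow>
     inj_on pos (verts G) \<and>
     (\<forall>e\<in>edges G. simple_path (crv e) \<and>
        {pathstart (crv e), pathfinish (crv e)} = pos ` ends G e \<and>
        path_image (crv e) \<inter> pos ` verts G = pos ` ends G e) \<and>
     (\<forall>e\<in>edges G. \<forall>e'\<in>edges G. e \<noteq> e' \<longrightarrow>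
        path_image (crv e) \<inter> path_image (crv e') = pos ` (ends G e \<inter> ends G e'))"

definition drawing :: "('e \<Rightarrow> real \<Rightarrow> complex) \<Rightarrow> 'e set \<Rightarrow> complex set" where
  "drawing crv A = (\<Union>e\<in>A. path_image (crv e))"

text \<open>Faces of the graph formed by the edges \<open>X\<close> and the nodes incident to them.\<close>

definition faces :: "('e \<Rightarrow> real \<Rightarrow> complex) \<Rightarrow> 'e set \<Rightarrow> complex set set" where
  "faces crv X = components (- drawing crv X)"


section \<open>Failure scenarios\<close>

definition max_failure :: "nat \<Rightarrow> (nat \<Rightarrow> 'e set) \<Rightarrow> nat" where
  "max_failure m Fs = Max ((\<lambda>j. card (Fs j)) ` {1..m})"

definition scenarios :: "('v, 'e) mgraph \<Rightarrow> nat \<Rightarrow> (nat \<Rightarrow> 'e set) \<Rightarrow> nat \<Rightarrow> 'e set set" where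
  "scenarios G m Fs r = {F. F \<subseteq> edges G \<and> (\<exists>j\<in>{1..m}. F \<subseteq> Fs j) \<and> card F \<le> r}"

definition feasible ::
  "('v, 'e) mgraph \<Rightarrow> nat \<Rightarrow> (nat \<Rightarrow> 'e set) \<Rightarrow> 'v \<Rightarrow> 'v \<Rightarrow> nat \<Rightarrow> 'e set \<Rightarrow> bool" where
  "feasible G m Fs s t r S \<longleftrightarrow>
     S \<subseteq> edges G \<and> (\<forall>F\<in>scenarios G m Fs r. joined G (S - F) s t)"

definition relevant ::
  "('v, 'e) mgraph \<Rightarrow> nat \<Rightarrow> (nat \<Rightarrow> 'e set) \<Rightarrow> 'v \<Rightarrow> 'v \<Rightarrow> nat \<Rightarrow> 'e set \<Rightarrow> 'e set set" where
  "relevant G m Fs s t i X = {F \<in> scenarios G m Fs i. \<not> joined G (X - F) s t}"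

text \<open>Relevant scenarios are subsets of \<open>X\<close> of cardinality exactly \<open>i\<close>.\<close>

lemma relevant_subset_card:
  assumes "multigraph G" "1 \<le> i" "feasible G m Fs s t (i - 1) X" "F \<in> relevant G m Fs s t i X"
  shows "F \<subseteq> X" "card F = i"
proof -
  have F: "F \<subseteq> edges G" "\<exists>j\<in>{1..m}. F \<subseteq> Fs j" "card F \<le> i" "\<not> joined G (X - F) s t"
    using assms(4) by (auto simp: relevant_def scenarios_def)
  have fin: "finite F"
    using F(1) assms(1) finite_subset by (auto simp: multigraph_def)
  have "F \<inter> X \<notin> scenarios G m Fs (i - 1)"
  proof
    assume "F \<inter> X \<in> scenarios G m Fs (i - 1)"
    then have "joined G (X - F \<inter> X) s t"
      using assms(3) by (auto simp: feasible_def)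
    moreover have "X - F \<inter> X = X - F" by auto
    ultimately show False using F(4) by simp
  qed
  then have "\<not> card (F \<inter> X) \<le> i - 1"
    using F(1,2) by (auto simp: scenarios_def)
  then have ge: "i \<le> card (F \<inter> X)" by simp
  have "card (F \<inter> X) \<le> card F" by (rule card_mono[OF fin]) auto
  then show "card F = i" using ge F(3) by simp
  then have "F \<inter> X = F" using ge fin by (intro card_seteq) auto
  then show "F \<subseteq> X" by auto
qed


section \<open>Links\<close>

definition incident_nodes :: "('v, 'e) mgraph \<Rightarrow> 'e set \<Rightarrow> 'v set" where
  "incident_nodes G X = (\<Union>e\<in>X. ends G e)"

text \<open>The component of \<open>u\<close> in the graph on the nodes incident to \<open>X\<close> with edge set \<open>X - F\<close>; for
  \<open>u = s\<close> and \<open>u = t\<close> these are the two sides of the cut formed by \<open>F\<close>.\<close>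

definition side :: "('v, 'e) mgraph \<Rightarrow> 'e set \<Rightarrow> 'e set \<Rightarrow> 'v \<Rightarrow> 'v set" where
  "side G X F u = {v \<in> incident_nodes G X. joined G (X - F) u v}"

definition link_pairs :: "('v, 'e) mgraph \<Rightarrow> 'e set \<Rightarrow> 'v set set" where
  "link_pairs G X =
     {{u, v} | u v. u \<in> incident_nodes G X \<and> v \<in> incident_nodes G X \<and> u \<noteq> v \<and>
                    joined G (edges G - X) u v}"

definition is_link_system ::
  "('v, 'e) mgraph \<Rightarrow> ('e \<Rightarrow> nat) \<Rightarrow> 'e set \<Rightarrow> ('v set \<Rightarrow> 'e set) \<Rightarrow> bool" where
  "is_link_system G w X L \<longleftrightarrow>
     (\<forall>u v. {u, v} \<in> link_pairs G X \<longrightarrow> is_shortest_path G w (edges G - X) u v (L {u, v}))"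

definition covers :: "('v, 'e) mgraph \<Rightarrow> 'v \<Rightarrow> 'v \<Rightarrow> 'e set \<Rightarrow> 'v set \<Rightarrow> 'e set \<Rightarrow> bool" where
  "covers G s t X p F \<longleftrightarrow> (\<exists>u v. p = {u, v} \<and> u \<in> side G X F s \<and> v \<in> side G X F t)"

definition cover :: "('v, 'e) mgraph \<Rightarrow> 'v \<Rightarrow> 'v \<Rightarrow> 'e set \<Rightarrow> 'e set \<Rightarrow> 'v set set" where
  "cover G s t X F = {p \<in> link_pairs G X. covers G s t X p F}"

text \<open>The type of a link is given by the face \<open>\<psi>\<close> itself instead of an index.\<close>

definition of_type ::
  "('v \<Rightarrow> complex) \<Rightarrow> ('e \<Rightarrow> real \<Rightarrow> complex) \<Rightarrow> ('v set \<Rightarrow> 'e set) \<Rightarrow> complex set \<Rightarrow> 'v set \<Rightarrow> bool" where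
  "of_type pos crv L \<psi> p \<longleftrightarrow> pos ` p \<subseteq> frontier \<psi> \<and> drawing crv (L p) \<subseteq> closure \<psi>"

definition typed ::
  "('v \<Rightarrow> complex) \<Rightarrow> ('e \<Rightarrow> real \<Rightarrow> complex) \<Rightarrow> 'e set \<Rightarrow> ('v set \<Rightarrow> 'e set) \<Rightarrow> 'v set \<Rightarrow> bool" where
  "typed pos crv X L p \<longleftrightarrow> (\<exists>\<psi>\<in>faces crv X. of_type pos crv L \<psi> p)"

definition clean ::
  "('v, 'e) mgraph \<Rightarrow> ('v \<Rightarrow> complex) \<Rightarrow> ('e \<Rightarrow> real \<Rightarrow> complex) \<Rightarrow> 'e set \<Rightarrow> ('v set \<Rightarrow> 'e set)
     \<Rightarrow> ('v set \<Rightarrow> real) \<Rightarrow> bool" where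
  "clean G pos crv X L x \<longleftrightarrow> (\<forall>p\<in>link_pairs G X. \<not> typed pos crv X L p \<longrightarrow> x p = 0)"


section \<open>The linear program\<close>

definition link_length :: "('e \<Rightarrow> nat) \<Rightarrow> ('v set \<Rightarrow> 'e set) \<Rightarrow> 'v set \<Rightarrow> real" where
  "link_length w L p = real (sum w (L p))"

definition lp_feasible ::
  "('v, 'e) mgraph \<Rightarrow> 'v \<Rightarrow> 'v \<Rightarrow> 'e set \<Rightarrow> 'e set set \<Rightarrow> ('v set \<Rightarrow> real) \<Rightarrow> bool" where
  "lp_feasible G s t X \<Omega> x \<longleftrightarrow>
     (\<forall>p\<in>link_pairs G X. x p \<ge> 0) \<and> (\<forall>F\<in>\<Omega>. (\<Sum>p\<in>cover G s t X F. x p) \<ge> 1)"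

definition lp_cost ::
  "('v, 'e) mgraph \<Rightarrow> ('e \<Rightarrow> nat) \<Rightarrow> 'e set \<Rightarrow> ('v set \<Rightarrow> 'e set) \<Rightarrow> ('v set \<Rightarrow> real) \<Rightarrow> real" where
  "lp_cost G w X L x = (\<Sum>p\<in>link_pairs G X. link_length w L p * x p)"

end

theory Submission
  imports Defs
begin

text \<open>
  A relevant scenario \<open>F\<close> is a minimal cut of the plane graph \<open>X\<close>, because \<open>X\<close> is feasible for all smaller
  scenarios: it consists of all edges between two connected sides, one with \<open>s\<close> and one with \<open>t\<close>
  (\<open>minimal_cut_bond\<close>). Seen from a face of \<open>X\<close>, such a bond is very simple. The boundary of the
  face is a closed tour, and \<open>F\<close> either misses it or crosses it exactly twice. So one side of \<open>F\<close> is an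
  interval of positions on the tour, and a link between two nodes of the face covers \<open>F\<close> if and only if
  exactly one of its ends lies in that interval (\<open>bonds_are_intervals_on_face\<close>).

  The bound is a product of two losses. First, the \<open>i\<close> edges of \<open>F\<close> border two faces each, and every
  face that is crossed uses up two of these edges; hence \<open>F\<close> is crossed by at most \<open>i\<close> faces
  (\<open>card_crossed_faces\<close>). A clean solution uses only links with both ends on a common face, so one of these
  faces contributes at least \<open>1 / i\<close> to the covering of \<open>F\<close>. Scaling by \<open>i\<close> separates the problem into one
  problem per face (\<open>rounding_by_classes\<close>). Secondly, a problem on a single face loses a factor 8
  (\<open>interval_cut_cover_le_8_fractional\<close>): a factor 2 because a link may enter an interval from the left or
  from the right and only one of the two directions is guaranteed half of the fractional covering, a
  factor 2 because both directions are paid for, and a factor 2 for rounding in one direction. In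
  one direction the problem is to cover points of a line by intervals, where each point imposes a bound on
  the right ends of the intervals that may be used. There a minimal cover has at most two intervals serving
  the point with the tightest bound, which is what a local ratio argument needs.

  The topological facts all rest on \<open>boundary_cut_even\<close>: the boundary of a face meets every cut in an even
  number of edges. Applied to the cut around a single node it gives even degrees, hence an Euler tour,
  since the boundary is connected. Applied to a subgraph in which only three edges of a bond are kept,
  it shows that no bond crosses a face boundary three times (\<open>bond_crosses_boundary_twice\<close>). It is
  proved by induction on the number of edges: modulo 2, the boundaries of the faces on one side of a cycle
  add up to the cycle. For this one has to know that an edge on a cycle borders exactly one face on
  each side of the cycle, for which Janiszewski's theorem is used in addition to the Jordan curve theorem.
\<close>

section \<open>Covering intervals of positions by links\<close>

text \<open>An interval of positions \<open>{a..b}\<close> is entered from the left by the link with ends \<open>l < r\<close> when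
  the link starts before it and stops in it. Entering from the right is the same relation after
  reflecting all positions at \<open>0\<close>.\<close>

definition enters :: "int \<Rightarrow> int \<Rightarrow> int \<Rightarrow> int \<Rightarrow> bool" where
  "enters l r a b \<longleftrightarrow> l < a \<and> a \<le> r \<and> r \<le> b"

text \<open>Among the links through \<open>a j\<close>, the one that starts first and the one that ends last together cover
  every position that any of them covers. A third link would need a demand of its own; there one
  of these two contains the position, and it also respects the bound, because it ends no later
  than \<open>b j\<close>, the smallest bound of all.\<close>

lemma card_minimal_cover_tightest_le_2:
  fixes l r :: "'p \<Rightarrow> int" and a b :: "'q \<Rightarrow> int"
  assumes "finite S" and j: "j \<in> Q" "\<And>q. q \<in> Q \<Longrightarrow> b j \<le> b q"
    and wit: "\<And>p. p \<in> S \<Longrightarrow> \<exists>q\<in>Q. enters (l p) (r p) (a q) (b q) \<and>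
                (\<forall>p'\<in>S. enters (l p') (r p') (a q) (b q) \<longrightarrow> p' = p)"
  shows "card {p \<in> S. enters (l p) (r p) (a j) (b j)} \<le> 2"
proof (cases "{p \<in> S. enters (l p) (r p) (a j) (b j)} = {}")
  case True
  then show ?thesis by (metis card.empty zero_le)
next
  case False
  define K where "K = {p \<in> S. enters (l p) (r p) (a j) (b j)}"
  have K: "finite K" "K \<noteq> {}" using False assms(1) by (auto simp: K_def)
  obtain p where p: "p \<in> K" "\<forall>z\<in>K. l p \<le> l z"
    using ex_is_arg_min_if_finite[OF K, of l] by (auto simp: is_arg_min_linorder)
  obtain q where q: "q \<in> K" "\<forall>z\<in>K. r z \<le> r q"
    using ex_is_arg_min_if_finite[OF K, of "\<lambda>z. - r z"] by (auto simp: is_arg_min_linorder)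
  have "z \<in> {p, q}" if z: "z \<in> K" for z
  proof -
    have "z \<in> S" using z by (simp add: K_def)
    from wit[OF this] obtain k where k: "k \<in> Q" "enters (l z) (r z) (a k) (b k)"
      "\<forall>p'\<in>S. enters (l p') (r p') (a k) (b k) \<longrightarrow> p' = z"
      by (elim bexE conjE) (rule that)
    have "p \<in> S" "q \<in> S" using p(1) q(1) by (simp_all add: K_def)
    have "enters (l p) (r p) (a k) (b k) \<or> enters (l q) (r q) (a k) (b k)"
      using p(1) bspec[OF p(2) z] q(1) bspec[OF q(2) z] z k(2) j(2)[OF k(1)]
      by (auto simp: K_def enters_def)
    then show ?thesis using k(3) \<open>p \<in> S\<close> \<open>q \<in> S\<close> by blast
  qed
  then have "K \<subseteq> {p, q}" by auto
  then have "card K \<le> card {p, q}" by (rule card_mono[rotated]) simp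
  also have "\<dots> \<le> 2" by (simp add: card_insert_if)
  finally show ?thesis by (simp add: K_def)
qed

text \<open>The local ratio argument for covering by one-sided links. Subtract the same amount from the cost of
  all links serving the tightest demand \<open>j\<close>, until one of them, \<open>z\<close>, is free; solve the demands not
  served by \<open>z\<close>; add \<open>z\<close> only if it is needed. The fractional solution pays the subtracted amount at
  least once, and a minimal cover pays it at most twice. Minimality is part of the statement because
  the induction has to carry it along.\<close>

lemma minimal_cover_le_2_fractional:
  fixes l r :: "'p \<Rightarrow> int" and a b :: "'q \<Rightarrow> int" and c x :: "'p \<Rightarrow> real"
  assumes "finite P" "finite Q" "\<forall>p\<in>P. 0 \<le> c p" "\<forall>p\<in>P. 0 \<le> x p"
    and "\<forall>q\<in>Q. 1 \<le> (\<Sum>p | p \<in> P \<and> enters (l p) (r p) (a q) (b q). x p)"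
  shows "\<exists>S\<subseteq>P. (\<forall>q\<in>Q. \<exists>p\<in>S. enters (l p) (r p) (a q) (b q)) \<and>
           (\<forall>p\<in>S. \<exists>q\<in>Q. enters (l p) (r p) (a q) (b q) \<and>
                (\<forall>p'\<in>S. enters (l p') (r p') (a q) (b q) \<longrightarrow> p' = p)) \<and>
           (\<Sum>p\<in>S. c p) \<le> 2 * (\<Sum>p\<in>P. c p * x p)"
  using assms(2,3,5)
proof (induction "card Q" arbitrary: Q c rule: less_induct)
  case less
  show ?case
  proof (cases "Q = {}")
    case True
    have "0 \<le> 2 * (\<Sum>p\<in>P. c p * x p)"
      using less.prems(2) assms(4) by (simp add: sum_nonneg)
    then show ?thesis using True by (intro exI[of _ "{}"]) auto
  next
    case False
    define cov where "cov p q \<longleftrightarrow> enters (l p) (r p) (a q) (b q)" for p q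
    obtain j where j: "j \<in> Q" "\<And>q. q \<in> Q \<Longrightarrow> b j \<le> b q"
      using ex_is_arg_min_if_finite[OF less.prems(1) False, of b]
      by (auto simp: is_arg_min_linorder)
    define K where "K = {p \<in> P. cov p j}"
    have sumK: "1 \<le> sum x K" using less.prems(3) j(1) by (simp add: K_def cov_def)
    have K: "finite K" "K \<subseteq> P" using assms(1) by (auto simp: K_def)
    have "K \<noteq> {}" using sumK by auto
    note K = K(1) this K(2)
    obtain z where z: "z \<in> K" "\<And>p. p \<in> K \<Longrightarrow> c z \<le> c p"
      using ex_is_arg_min_if_finite[OF K(1,2), of c] by (auto simp: is_arg_min_linorder)
    (* The amount c z is the largest that keeps all costs nonnegative. *)
    define c' where "c' p = (if p \<in> K then c p - c z else c p)" for p
    define Q' where "Q' = {q \<in> Q. \<not> cov z q}"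
    have "Q' \<subset> Q" using j(1) z(1) by (auto simp: Q'_def K_def)
    then have "card Q' < card Q" using less.prems(1) psubset_card_mono by blast
    have c'0: "\<forall>p\<in>P. 0 \<le> c' p" using less.prems(2) z(2) by (auto simp: c'_def)
    have fracQ': "\<forall>q\<in>Q'. 1 \<le> (\<Sum>p | p \<in> P \<and> enters (l p) (r p) (a q) (b q). x p)"
      using less.prems(3) by (auto simp: Q'_def)
    have finQ': "finite Q'" using less.prems(1) by (simp add: Q'_def)
    obtain S' where S': "S' \<subseteq> P" "\<forall>q\<in>Q'. \<exists>p\<in>S'. cov p q"
      "\<forall>p\<in>S'. \<exists>q\<in>Q'. cov p q \<and> (\<forall>p'\<in>S'. cov p' q \<longrightarrow> p' = p)"
      "(\<Sum>p\<in>S'. c' p) \<le> 2 * (\<Sum>p\<in>P. c' p * x p)"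
      using less.hyps[of Q' c', OF \<open>card Q' < card Q\<close> finQ' c'0 fracQ', folded cov_def]
      by (elim exE conjE) (rule that)
    define S where "S = (if \<forall>q\<in>Q. \<exists>p\<in>S'. cov p q then S' else insert z S')"
    have finS': "finite S'" using S'(1) assms(1) finite_subset by blast
    have SP: "S \<subseteq> P" "finite S" using S'(1) z(1) K(3) finS' by (auto simp: S_def)
    have cov: "\<exists>p\<in>S. cov p q" if "q \<in> Q" for q
      using that S'(2) by (cases "cov z q") (auto simp: S_def Q'_def)
    have min: "\<exists>q\<in>Q. cov p q \<and> (\<forall>p'\<in>S. cov p' q \<longrightarrow> p' = p)" if p: "p \<in> S" for p
    proof (cases "p \<in> S'")
      case True
      then obtain q where "q \<in> Q'" "cov p q" "\<forall>p'\<in>S'. cov p' q \<longrightarrow> p' = p"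
        using S'(3) by blast
      moreover have "p' = p" if "cov z q" for p' using \<open>q \<in> Q'\<close> that by (simp add: Q'_def)
      moreover have "q \<in> Q" using \<open>q \<in> Q'\<close> by (simp add: Q'_def)
      moreover have "p' \<in> S' \<or> p' = z" if "p' \<in> S" for p'
        using that by (auto simp: S_def split: if_splits)
      ultimately show ?thesis by metis
    next
      case False
      then have nc: "\<not> (\<forall>q\<in>Q. \<exists>p\<in>S'. cov p q)" and "p = z"
        using p by (auto simp: S_def split: if_splits)
      then obtain q where "q \<in> Q" "\<forall>p\<in>S'. \<not> cov p q" by blast
      moreover have "cov z q" using calculation S'(2) unfolding Q'_def by blast
      moreover have "S = insert z S'" using nc by (simp only: S_def if_False)
      ultimately show ?thesis using \<open>p = z\<close> by blast
    qed
    have "card {p \<in> S. cov p j} \<le> 2"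
      unfolding cov_def
      by (rule card_minimal_cover_tightest_le_2[OF SP(2) j min[unfolded cov_def]])
    moreover have "{p \<in> S. cov p j} = S \<inter> K" using SP(1) by (auto simp: K_def)
    ultimately have two: "card (S \<inter> K) \<le> 2" by simp
    have cz: "0 \<le> c z" using less.prems(2) z(1) K(3) by blast
    have "(\<Sum>p\<in>S. c p) = (\<Sum>p\<in>S. c' p + (if p \<in> K then c z else 0))"
      by (rule sum.cong) (auto simp: c'_def)
    also have "\<dots> = (\<Sum>p\<in>S. c' p) + c z * card (S \<inter> K)"
      using sum.inter_restrict[OF SP(2), of "\<lambda>_. c z" K]
      by (simp add: sum.distrib mult.commute)
    also have "(\<Sum>p\<in>S. c' p) = (\<Sum>p\<in>S'. c' p)"
      using finS' z(1) by (cases "z \<in> S'") (auto simp: S_def c'_def insert_absorb)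
    also have "(\<Sum>p\<in>S'. c' p) + c z * card (S \<inter> K) \<le> 2 * (\<Sum>p\<in>P. c' p * x p) + c z * 2"
      using S'(4) two cz by (intro add_mono mult_left_mono) auto
    also have "\<dots> \<le> 2 * (\<Sum>p\<in>P. c' p * x p) + c z * (2 * sum x K)"
      using sumK cz by (intro add_mono mult_left_mono) auto
    also have "\<dots> = 2 * ((\<Sum>p\<in>P. c' p * x p) + c z * sum x K)" by simp
    also have "c z * sum x K = (\<Sum>p\<in>P. if p \<in> K then c z * x p else 0)"
      using sum.inter_restrict[OF assms(1), of "\<lambda>p. c z * x p" K] K(3)
      by (simp add: sum_distrib_left Int_absorb1)
    also have "(\<Sum>p\<in>P. c' p * x p) + \<dots> = (\<Sum>p\<in>P. c p * x p)"
      unfolding sum.distrib[symmetric]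
      by (rule sum.cong) (auto simp: c'_def algebra_simps)
    finally have "(\<Sum>p\<in>S. c p) \<le> 2 * (\<Sum>p\<in>P. c p * x p)" .
    then show ?thesis
      unfolding cov_def[symmetric]
      by (intro exI[of _ S] conjI ballI SP(1) cov min)
  qed
qed

text \<open>A link that separates the interval from its complement enters it from the left or from the right,
  so one of the two directions carries at least half of the fractional cover. Doubling \<open>x\<close>, solving
  each direction up to a factor 2 and paying for both gives \<open>2 * 2 * 2\<close>.\<close>

lemma interval_cut_cover_le_8_fractional:
  fixes l r :: "'p \<Rightarrow> int" and a b :: "'q \<Rightarrow> int" and c x :: "'p \<Rightarrow> real"
  assumes fin: "finite P" "finite Q"
    and c: "\<forall>p\<in>P. 0 \<le> c p" and x: "\<forall>p\<in>P. 0 \<le> x p"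
    and lr: "\<forall>p\<in>P. l p \<le> r p"
    and frac: "\<forall>q\<in>Q. 1 \<le> (\<Sum>p | p \<in> P \<and> (l p \<in> {a q..b q}) \<noteq> (r p \<in> {a q..b q}). x p)"
  shows "\<exists>S\<subseteq>P. (\<forall>q\<in>Q. \<exists>p\<in>S. (l p \<in> {a q..b q}) \<noteq> (r p \<in> {a q..b q})) \<and>
           (\<Sum>p\<in>S. c p) \<le> 8 * (\<Sum>p\<in>P. c p * x p)"
proof -
  define A where "A q = {p \<in> P. enters (l p) (r p) (a q) (b q)}" for q
  define B where "B q = {p \<in> P. enters (- r p) (- l p) (- b q) (- a q)}" for q
  have split: "{p \<in> P. (l p \<in> {a q..b q}) \<noteq> (r p \<in> {a q..b q})} = A q \<union> B q" for q
    using lr by (fastforce simp: A_def B_def enters_def)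
  have disj: "A q \<inter> B q = {}" for q
    by (auto simp: A_def B_def enters_def)
  have half: "1 \<le> (\<Sum>p\<in>A q. 2 * x p) \<or> 1 \<le> (\<Sum>p\<in>B q. 2 * x p)" if "q \<in> Q" for q
  proof -
    have "1 \<le> sum x (A q \<union> B q)" using bspec[OF frac that] unfolding split .
    also have "\<dots> = sum x (A q) + sum x (B q)"
      by (rule sum.union_disjoint) (use fin disj in \<open>auto simp: A_def B_def\<close>)
    finally show ?thesis by (auto simp: sum_distrib_left[symmetric])
  qed
  define QA where "QA = {q \<in> Q. 1 \<le> (\<Sum>p\<in>A q. 2 * x p)}"
  define QB where "QB = {q \<in> Q. 1 \<le> (\<Sum>p\<in>B q. 2 * x p)}"
  have x2: "\<forall>p\<in>P. 0 \<le> 2 * x p" using x by simp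
  have finQ: "finite QA" "finite QB" using fin(2) by (simp_all add: QA_def QB_def)
  have "\<forall>q\<in>QA. 1 \<le> (\<Sum>p | p \<in> P \<and> enters (l p) (r p) (a q) (b q). 2 * x p)"
    by (simp add: QA_def A_def)
  from minimal_cover_le_2_fractional[of P QA c "\<lambda>p. 2 * x p" l r a b, OF fin(1) finQ(1) c x2 this]
  obtain S where S: "S \<subseteq> P" "\<forall>q\<in>QA. \<exists>p\<in>S. enters (l p) (r p) (a q) (b q)"
    "(\<Sum>p\<in>S. c p) \<le> 2 * (\<Sum>p\<in>P. c p * (2 * x p))"
    by (elim exE conjE) (rule that)
  have "\<forall>q\<in>QB.
      1 \<le> (\<Sum>p | p \<in> P \<and> enters (- r p) (- l p) (- b q) (- a q). 2 * x p)"
    by (simp add: QB_def B_def)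
  from minimal_cover_le_2_fractional[of P QB c "\<lambda>p. 2 * x p"
      "\<lambda>p. - r p" "\<lambda>p. - l p" "\<lambda>q. - b q" "\<lambda>q. - a q", OF fin(1) finQ(2) c x2 this]
  obtain T where T: "T \<subseteq> P" "\<forall>q\<in>QB. \<exists>p\<in>T. enters (- r p) (- l p) (- b q) (- a q)"
    "(\<Sum>p\<in>T. c p) \<le> 2 * (\<Sum>p\<in>P. c p * (2 * x p))"
    by (elim exE conjE) (rule that)
  have finST: "finite S" "finite T" using S(1) T(1) fin(1) finite_subset by auto
  have "0 \<le> sum c (S \<inter> T)" using S(1) c by (intro sum_nonneg) blast
  then have "(\<Sum>p\<in>S \<union> T. c p) \<le> (\<Sum>p\<in>S. c p) + (\<Sum>p\<in>T. c p)"
    using sum_Un[OF finST, of c] by simp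
  also have "\<dots> \<le> 8 * (\<Sum>p\<in>P. c p * x p)"
  proof -
    have "(\<Sum>p\<in>P. c p * (2 * x p)) = 2 * (\<Sum>p\<in>P. c p * x p)"
      unfolding sum_distrib_left by (rule sum.cong) simp_all
    then show ?thesis using S(3) T(3) by linarith
  qed
  finally have cost: "(\<Sum>p\<in>S \<union> T. c p) \<le> 8 * (\<Sum>p\<in>P. c p * x p)" .
  have "\<exists>p\<in>S \<union> T. (l p \<in> {a q..b q}) \<noteq> (r p \<in> {a q..b q})" if q: "q \<in> Q" for q
  proof -
    have "q \<in> QA \<or> q \<in> QB" using half[OF q] q by (auto simp: QA_def QB_def)
    then have "\<exists>p\<in>S \<union> T. p \<in> A q \<union> B q"
      using S(1,2) T(1,2) unfolding A_def B_def by blast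
    then show ?thesis unfolding split[symmetric] by blast
  qed
  then show ?thesis using S(1) T(1) cost by (intro exI[of _ "S \<union> T"]) auto
qed

text \<open>If every demand is covered by links of at most \<open>n\<close> classes, then some class covers it to an extent of
  at least \<open>1 / n\<close>. After scaling by \<open>n\<close> the classes are independent problems, and since they
  partition the links, their costs add up without loss.\<close>

lemma rounding_by_classes:
  fixes c x :: "'p \<Rightarrow> real" and cls :: "'p \<Rightarrow> 't" and cov :: "'p \<Rightarrow> 'q \<Rightarrow> bool"
  assumes fin: "finite P" "finite Q"
    and x: "\<forall>p\<in>P. 0 \<le> x p"
    and frac: "\<forall>q\<in>Q. 1 \<le> (\<Sum>p | p \<in> P \<and> cov p q. x p)"
    and few: "\<forall>q\<in>Q. card (cls ` {p \<in> P. cov p q}) \<le> n"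
    and round: "\<And>R k y. R \<subseteq> Q \<Longrightarrow> k \<in> cls ` P \<Longrightarrow> \<forall>p\<in>P. 0 \<le> y p \<Longrightarrow>
        \<forall>q\<in>R. 1 \<le> (\<Sum>p | p \<in> {p \<in> P. cls p = k} \<and> cov p q. y p) \<Longrightarrow>
        \<exists>S\<subseteq>{p \<in> P. cls p = k}. (\<forall>q\<in>R. \<exists>p\<in>S. cov p q) \<and>
          (\<Sum>p\<in>S. c p) \<le> g * (\<Sum>p | p \<in> P \<and> cls p = k. c p * (y p :: real))"
  shows "\<exists>S\<subseteq>P. (\<forall>q\<in>Q. \<exists>p\<in>S. cov p q) \<and> (\<Sum>p\<in>S. c p) \<le> g * real n * (\<Sum>p\<in>P. c p * x p)"
proof -
  define R where
    "R k = {q \<in> Q. 1 \<le> (\<Sum>p | p \<in> {p \<in> P. cls p = k} \<and> cov p q. real n * x p)}" for k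
  have ex: "\<exists>k\<in>cls ` P. q \<in> R k" if q: "q \<in> Q" for q
  proof (rule ccontr)
    assume none: "\<not> (\<exists>k\<in>cls ` P. q \<in> R k)"
    define C where "C = {p \<in> P. cov p q}"
    have sumC: "1 \<le> sum x C" using bspec[OF frac q] by (simp add: C_def)
    have C: "finite C" "C \<noteq> {}" using fin sumC by (simp add: C_def, auto)
    have "real n \<le> (\<Sum>p\<in>C. real n * x p)"
      using mult_left_mono[OF bspec[OF frac q], of "real n"] by (simp add: C_def sum_distrib_left)
    also have "\<dots> = (\<Sum>k\<in>cls ` C. \<Sum>p | p \<in> C \<and> cls p = k. real n * x p)"
      by (rule sum.image_gen[OF C(1)])
    also have "\<dots> < (\<Sum>k\<in>cls ` C. 1)"
    proof (rule sum_strict_mono)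
      fix k assume "k \<in> cls ` C"
      then have "k \<in> cls ` P" by (auto simp: C_def)
      then have "\<not> 1 \<le> (\<Sum>p | p \<in> {p \<in> P. cls p = k} \<and> cov p q. real n * x p)"
        using none q by (auto simp: R_def)
      moreover have "{p \<in> C. cls p = k} = {p. p \<in> {p \<in> P. cls p = k} \<and> cov p q}"
        by (auto simp: C_def)
      ultimately show "(\<Sum>p | p \<in> C \<and> cls p = k. real n * x p) < 1" by simp
    qed (use C in auto)
    also have "\<dots> \<le> real n" using bspec[OF few q] by (simp add: C_def)
    finally show False by simp
  qed
  have "\<exists>S\<subseteq>{p \<in> P. cls p = k}. (\<forall>q\<in>R k. \<exists>p\<in>S. cov p q) \<and>
          (\<Sum>p\<in>S. c p) \<le> g * (\<Sum>p | p \<in> P \<and> cls p = k. c p * (real n * x p))"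
    if "k \<in> cls ` P" for k
    using round[of "R k" k "\<lambda>p. real n * x p"] that x by (simp add: R_def)
  then have "\<forall>k\<in>cls ` P. \<exists>S. S \<subseteq> {p \<in> P. cls p = k} \<and> (\<forall>q\<in>R k. \<exists>p\<in>S. cov p q) \<and>
          (\<Sum>p\<in>S. c p) \<le> g * (\<Sum>p | p \<in> P \<and> cls p = k. c p * (real n * x p))"
    by blast
  from bchoice[OF this] obtain S where
    S0: "\<forall>k\<in>cls ` P. S k \<subseteq> {p \<in> P. cls p = k} \<and> (\<forall>q\<in>R k. \<exists>p\<in>S k. cov p q) \<and>
          (\<Sum>p\<in>S k. c p) \<le> g * (\<Sum>p | p \<in> P \<and> cls p = k. c p * (real n * x p))" ..
  have S: "S k \<subseteq> {p \<in> P. cls p = k}" "\<forall>q\<in>R k. \<exists>p\<in>S k. cov p q"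
      "(\<Sum>p\<in>S k. c p) \<le> g * (\<Sum>p | p \<in> P \<and> cls p = k. c p * (real n * x p))"
    if "k \<in> cls ` P" for k using S0[rule_format, OF that] by simp_all
  define T where "T = (\<Union>k\<in>cls ` P. S k)"
  have "T \<subseteq> P" using S(1) by (auto simp: T_def)
  moreover have "\<forall>q\<in>Q. \<exists>p\<in>T. cov p q"
  proof
    fix q assume "q \<in> Q"
    then obtain k where k: "k \<in> cls ` P" "q \<in> R k" using ex by blast
    from bspec[OF S(2)[OF k(1)] k(2)] show "\<exists>p\<in>T. cov p q" using k(1) unfolding T_def by blast
  qed
  moreover have "(\<Sum>p\<in>T. c p) \<le> g * real n * (\<Sum>p\<in>P. c p * x p)"
  proof -
    have "(\<Sum>p\<in>T. c p) = (\<Sum>k\<in>cls ` P. \<Sum>p\<in>S k. c p)"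
      unfolding T_def
    proof (rule sum.UNION_disjoint)
      show "\<forall>k\<in>cls ` P. finite (S k)"
      proof
        fix k assume "k \<in> cls ` P"
        from finite_subset[OF S(1)[OF this]] fin(1) show "finite (S k)" by simp
      qed
      show "\<forall>k\<in>cls ` P. \<forall>k'\<in>cls ` P. k \<noteq> k' \<longrightarrow> S k \<inter> S k' = {}"
      proof (intro ballI impI)
        fix k k' assume k: "k \<in> cls ` P" "k' \<in> cls ` P" "k \<noteq> k'"
        show "S k \<inter> S k' = {}" using S(1)[OF k(1)] S(1)[OF k(2)] k(3) by auto
      qed
    qed (use fin in simp)
    also have "\<dots> \<le> (\<Sum>k\<in>cls ` P. g * (\<Sum>p | p \<in> P \<and> cls p = k. c p * (real n * x p)))"
      by (rule sum_mono) (use S(3) in auto)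
    also have "\<dots> = g * (\<Sum>p\<in>P. c p * (real n * x p))"
      unfolding sum_distrib_left[symmetric] sum.image_gen[OF fin(1), symmetric] ..
    also have "\<dots> = g * real n * (\<Sum>p\<in>P. c p * x p)"
      by (simp add: sum_distrib_left mult_ac)
    finally show ?thesis .
  qed
  ultimately show ?thesis by (intro exI[of _ T] conjI)
qed

section \<open>Walks, cuts and Euler tours\<close>

definition reach :: "('e \<Rightarrow> 'v set) \<Rightarrow> 'e set \<Rightarrow> 'v \<Rightarrow> 'v \<Rightarrow> bool" where
  "reach en A = (\<lambda>x y. \<exists>e\<in>A. en e = {x, y})\<^sup>*\<^sup>*"

lemma reach_refl [simp]: "reach en A u u"
  by (simp add: reach_def)

lemma reach_edge: "e \<in> A \<Longrightarrow> en e = {u, v} \<Longrightarrow> reach en A u v"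
  unfolding reach_def by (rule r_into_rtranclp) auto

lemma reach_trans [trans]: "reach en A u v \<Longrightarrow> reach en A v w \<Longrightarrow> reach en A u w"
  unfolding reach_def by (rule rtranclp_trans)

lemma reach_sym: "reach en A u v \<Longrightarrow> reach en A v u"
  unfolding reach_def
  by (rule sympD[OF symp_rtranclp]) (auto simp: symp_def insert_commute)

lemma reach_mono: "A \<subseteq> B \<Longrightarrow> reach en A u v \<Longrightarrow> reach en B u v"
  unfolding reach_def by (erule rtranclp_mono[THEN predicate2D, rotated]) auto

lemma reach_induct [consumes 1, case_names refl step]:
  assumes "reach en A u v" "P u"
    and "\<And>x y e. reach en A u x \<Longrightarrow> P x \<Longrightarrow> e \<in> A \<Longrightarrow> en e = {x, y} \<Longrightarrow> P y"
  shows "P v"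
  using assms(1) unfolding reach_def
  by (induction rule: rtranclp_induct) (use assms(2,3) in \<open>auto simp: reach_def\<close>)

text \<open>Simple paths with their node set \<open>N\<close> and edge set \<open>P\<close>. Growing them at the end makes it possible to
  build the drawn curve, and to count cut edges, along the induction.\<close>

inductive spath :: "('e \<Rightarrow> 'v set) \<Rightarrow> 'e set \<Rightarrow> 'v \<Rightarrow> 'v set \<Rightarrow> 'e set \<Rightarrow> 'v \<Rightarrow> bool"
  for en A u where
  spath_refl: "spath en A u {u} {} u"
| spath_step: "spath en A u N P v \<Longrightarrow> e \<in> A \<Longrightarrow> en e = {v, z} \<Longrightarrow> z \<notin> N \<Longrightarrow>
    spath en A u (insert z N) (insert e P) z"

lemma spath_nodes:
  assumes "spath en A u N P v"
  shows "u \<in> N" "v \<in> N" "P \<subseteq> A" "finite P" "\<And>e. e \<in> P \<Longrightarrow> en e \<subseteq> N"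
  using assms by (induction) auto

text \<open>Cutting a path at one of its nodes is what removes loops when reachability is turned into a path.\<close>

lemma spath_prefix: "spath en A u N P v \<Longrightarrow> y \<in> N \<Longrightarrow> \<exists>N P. spath en A u N P y"
proof (induction rule: spath.induct)
  case spath_refl
  then show ?case using spath.spath_refl by fastforce
next
  case (spath_step N P v e z)
  then show ?case using spath.spath_step[OF spath_step.hyps] by blast
qed

lemma reach_imp_spath: "reach en A u v \<Longrightarrow> \<exists>N P. spath en A u N P v"
proof (induction rule: reach_induct)
  case refl
  show ?case by (intro exI) (rule spath_refl)
next
  case (step x y e)
  then obtain N P where NP: "spath en A u N P x" by blast
  show ?case
  proof (cases "y \<in> N")
    case True
    show ?thesis by (rule spath_prefix[OF NP True])
  next
    case False
    show ?thesis by (intro exI) (rule spath_step[OF NP step.hyps(2,3) False])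
  qed
qed

lemma is_path_imp_reach:
  assumes "is_path G A u v P"
  shows "reach (ends G) A u v"
proof -
  obtain vs es where p: "length vs = Suc (length es)" "hd vs = u" "last vs = v"
    "\<forall>n<length es. ends G (es ! n) = {vs ! n, vs ! Suc n}" "set es = P" "P \<subseteq> A"
    using assms unfolding is_path_def by blast
  have ne: "vs \<noteq> []" using p(1) by auto
  have "reach (ends G) A u (vs ! k)" if "k \<le> length es" for k
    using that
  proof (induction k)
    case 0
    then show ?case using p(2) ne by (simp add: hd_conv_nth)
  next
    case (Suc k)
    have "reach (ends G) A (vs ! k) (vs ! Suc k)"
      using Suc.prems p(4-6) nth_mem[of k es] by (intro reach_edge[of "es ! k"]) auto
    then show ?case using Suc reach_trans by fastforce
  qed
  from this[of "length es"] show ?thesis using p(1,3) ne by (simp add: last_conv_nth)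
qed

lemma spath_imp_is_path:
  assumes "spath (ends G) A u N P v" "multigraph G" "A \<subseteq> edges G" "u \<in> verts G"
  shows "is_path G A u v P"
proof -
  have "\<exists>vs es. length vs = Suc (length es) \<and> distinct vs \<and> set vs \<subseteq> verts G \<and> set vs = N \<and>
        hd vs = u \<and> last vs = v \<and>
        (\<forall>n<length es. ends G (es ! n) = {vs ! n, vs ! Suc n}) \<and> set es = P"
    using assms(1)
  proof (induction rule: spath.induct)
    case spath_refl
    then show ?case using assms(4) by (intro exI[of _ "[u]"] exI[of _ "[]"]) auto
  next
    case (spath_step N P v e z)
    then obtain vs es where p: "length vs = Suc (length es)" "distinct vs" "set vs \<subseteq> verts G"
      "set vs = N" "hd vs = u" "last vs = v"
      "\<forall>n<length es. ends G (es ! n) = {vs ! n, vs ! Suc n}" "set es = P" by blast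
    have ne: "vs \<noteq> []" using p(1) by auto
    have "e \<in> edges G" using spath_step.hyps(2) assms(3) by blast
    then have z: "z \<in> verts G" using spath_step.hyps(3) assms(2) by (auto simp: multigraph_def)
    have last: "vs ! length es = v" using p(1,6) ne by (simp add: last_conv_nth)
    have "ends G ((es @ [e]) ! n) = {(vs @ [z]) ! n, (vs @ [z]) ! Suc n}"
      if "n < length (es @ [e])" for n
    proof (cases "n < length es")
      case True
      then show ?thesis using p(1,7) by (simp add: nth_append)
    next
      case False
      then have "n = length es" using that by simp
      then show ?thesis using p(1) last spath_step.hyps(3) by (simp add: nth_append)
    qed
    then show ?case
      using p ne z spath_step.hyps(4)
      by (intro exI[of _ "vs @ [z]"] exI[of _ "es @ [e]"]) auto
  qed
  then show ?thesis using spath_nodes(3)[OF assms(1)] unfolding is_path_def by blast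
qed

lemma joined_iff_reach:
  assumes "multigraph G" "A \<subseteq> edges G" "u \<in> verts G"
  shows "joined G A u v \<longleftrightarrow> reach (ends G) A u v"
proof
  show "joined G A u v \<Longrightarrow> reach (ends G) A u v"
    unfolding joined_def by (auto dest: is_path_imp_reach)
next
  assume "reach (ends G) A u v"
  then show "joined G A u v"
    using reach_imp_spath[of "ends G" A u v] spath_imp_is_path assms unfolding joined_def by meson
qed

definition cut :: "('e \<Rightarrow> 'v set) \<Rightarrow> 'e set \<Rightarrow> 'v set \<Rightarrow> 'e set" where
  "cut en H U = {e \<in> H. en e \<inter> U \<noteq> {} \<and> en e - U \<noteq> {}}"

lemma cut_insert:
  "en e = {a, b} \<Longrightarrow> cut en (insert e P) U =
     (if (a \<in> U) = (b \<in> U) then cut en P U else insert e (cut en P U))"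
  by (auto simp: cut_def)

text \<open>A path changes sides each time it uses a cut edge.\<close>

lemma spath_cut_even:
  "spath en A u N P v \<Longrightarrow> even (card (cut en P U)) \<longleftrightarrow> (u \<in> U \<longleftrightarrow> v \<in> U)"
proof (induction rule: spath.induct)
  case spath_refl
  then show ?case by (simp add: cut_def)
next
  case (spath_step N P v e z)
  have "e \<notin> P" using spath_nodes(5)[OF spath_step.hyps(1), of e] spath_step.hyps(3,4) by auto
  then have "e \<notin> cut en P U" "finite (cut en P U)"
    using spath_nodes(4)[OF spath_step.hyps(1)] by (auto simp: cut_def)
  then show ?case using spath_step.IH by (auto simp: cut_insert[of en e v z, OF spath_step.hyps(3)])
qed

lemma cycle_cut_even:
  assumes "spath en (H - {e}) u N P v" "en e = {u, v}"
  shows "even (card (cut en (insert e P) U))"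
proof -
  have "e \<notin> P" "finite P" using spath_nodes(3,4)[OF assms(1)] by auto
  then have "e \<notin> cut en P U" "finite (cut en P U)" by (auto simp: cut_def)
  then show ?thesis using spath_cut_even[OF assms(1), of U] by (auto simp: cut_insert[of en e u v, OF assms(2)])
qed

definition trail :: "('e \<Rightarrow> 'v set) \<Rightarrow> 'e set \<Rightarrow> nat \<Rightarrow> (nat \<Rightarrow> 'v) \<Rightarrow> (nat \<Rightarrow> 'e) \<Rightarrow> bool" where
  "trail en C n p q \<longleftrightarrow> inj_on q {..<n} \<and> q ` {..<n} \<subseteq> C \<and> (\<forall>k<n. en (q k) = {p k, p (Suc k)})"

lemma trail_extend:
  assumes "trail en C n p q" "e \<in> C" "e \<notin> q ` {..<n}" "en e = {p n, z}"
  shows "trail en C (Suc n) (p(Suc n := z)) (q(n := e))"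
  using assms unfolding trail_def
  by (auto simp: lessThan_Suc less_Suc_eq inj_on_def)

text \<open>A closed trail can be started at any of its nodes, in particular at one where it can be extended.\<close>

lemma trail_rotate:
  assumes "trail en C n p q" "p n = p 0" "k < n"
  shows "trail en C n (\<lambda>j. p ((j + k) mod n)) (\<lambda>j. q ((j + k) mod n))"
    "(\<lambda>j. q ((j + k) mod n)) ` {..<n} = q ` {..<n}"
proof -
  have n: "0 < n" using assms(3) by simp
  have "m \<in> (\<lambda>j. (j + k) mod n) ` {..<n}" if "m < n" for m
  proof
    have "((m + (n - k)) mod n + k) mod n = (m + (n - k) + k) mod n" by (rule mod_add_left_eq)
    also have "\<dots> = m" using that assms(3) by simp
    finally show "m = ((m + (n - k)) mod n + k) mod n" ..
    show "(m + (n - k)) mod n \<in> {..<n}" using n by simp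
  qed
  then have img: "(\<lambda>j. (j + k) mod n) ` {..<n} = {..<n}" using n by auto
  then have inj: "inj_on (\<lambda>j. (j + k) mod n) {..<n}" by (intro eq_card_imp_inj_on) simp_all
  show "(\<lambda>j. q ((j + k) mod n)) ` {..<n} = q ` {..<n}"
    using arg_cong[OF img, of "image q"] by (simp add: image_image)
  have wrap: "p (Suc j mod n) = p (Suc j)" if "j < n" for j
    using that assms(2) by (cases "Suc j = n") auto
  have "en (q ((j + k) mod n)) = {p ((j + k) mod n), p ((Suc j + k) mod n)}" for j
  proof -
    have "(j + k) mod n < n" using n by simp
    moreover have "(Suc j + k) mod n = Suc ((j + k) mod n) mod n" by (simp add: mod_Suc_eq)
    ultimately show ?thesis using assms(1) wrap unfolding trail_def by metis
  qed
  moreover have "inj_on (\<lambda>j. q ((j + k) mod n)) {..<n}"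
    using comp_inj_on[OF inj, of q] assms(1) img by (simp add: trail_def comp_def)
  moreover have "(\<lambda>j. q ((j + k) mod n)) ` {..<n} \<subseteq> C"
    using assms(1) \<open>_ = q ` {..<n}\<close> by (simp add: trail_def)
  ultimately show "trail en C n (\<lambda>j. p ((j + k) mod n)) (\<lambda>j. q ((j + k) mod n))"
    unfolding trail_def by blast
qed

lemma trail_degree_even:
  assumes "trail en C n p q" "\<And>e. e \<in> C \<Longrightarrow> card (en e) = 2"
  shows "even (card {e \<in> q ` {..<n}. w \<in> en e}) \<longleftrightarrow> (p 0 = w \<longleftrightarrow> p n = w)"
  using assms(1)
proof (induction n)
  case 0
  then show ?case by simp
next
  case (Suc n)
  have t: "trail en C n p q" using Suc.prems by (auto simp: trail_def lessThan_Suc)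
  have e: "en (q n) = {p n, p (Suc n)}" "q n \<in> C" "q n \<notin> q ` {..<n}"
    using Suc.prems by (auto simp: trail_def lessThan_Suc)
  have "p n \<noteq> p (Suc n)" using assms(2)[OF e(2)] e(1) by (auto simp: card_insert_if)
  moreover have "{e \<in> q ` {..<Suc n}. w \<in> en e} =
      (if w \<in> {p n, p (Suc n)} then insert (q n) {e \<in> q ` {..<n}. w \<in> en e}
       else {e \<in> q ` {..<n}. w \<in> en e})"
    using e(1) by (auto simp: lessThan_Suc)
  ultimately show ?case using Suc.IH[OF t] e(3) by auto
qed

text \<open>Take a longest trail. It is closed, since at an end different from its start it has used an odd number
  of edges and could go on. If it missed an edge, connectedness would give a missing edge at one of its
  nodes; rotated to that node, the trail could be extended.\<close>

lemma euler_tour: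
  assumes fin: "finite C" and two: "\<And>e. e \<in> C \<Longrightarrow> card (en e) = 2" and "C \<noteq> {}"
    and deg: "\<And>v. even (card {e \<in> C. v \<in> en e})"
    and conn: "\<And>T. T \<subseteq> C \<Longrightarrow> T \<noteq> {} \<Longrightarrow> T \<noteq> C \<Longrightarrow> \<exists>e\<in>C - T. \<exists>e'\<in>T. en e \<inter> en e' \<noteq> {}"
  shows "\<exists>n p q. trail en C n p q \<and> q ` {..<n} = C \<and> p n = p 0"
proof -
  have bound: "n \<le> card C" if "trail en C n p q" for n p q
    using that card_inj_on_le[of q "{..<n}" C] fin by (simp add: trail_def)
  define n where "n = (GREATEST n. \<exists>p q. trail en C n p q)"
  have ex0: "\<exists>p q. trail en C 0 p q" by (simp add: trail_def)
  then obtain p q where t: "trail en C n p q"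
    unfolding n_def using GreatestI_nat[of "\<lambda>n. \<exists>p q. trail en C n p q" 0 "card C"] bound by blast
  have max: "m \<le> n" if "trail en C m p' q'" for m p' q'
    unfolding n_def using Greatest_le_nat[of "\<lambda>n. \<exists>p q. trail en C n p q" m "card C"] bound that
    by blast
  (* No trail of the maximal length n can be extended at its end. *)
  have stuck: False
    if tr: "trail en C n p' q'" and e: "e \<in> C" "e \<notin> q' ` {..<n}" "p' n \<in> en e" for p' q' e
  proof -
    obtain a b where "en e = {a, b}" using two[OF e(1)] by (meson card_2_iff)
    then obtain z where "en e = {p' n, z}" using e(3) by (auto simp: insert_commute)
    from max[OF trail_extend[OF tr e(1,2) this]] show False by simp
  qed
  have closed: "p n = p 0"
  proof (rule ccontr)
    assume "p n \<noteq> p 0"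
    then have "odd (card {e \<in> q ` {..<n}. p n \<in> en e})"
      using trail_degree_even[OF t two, of "p n"] by auto
    then have "{e \<in> q ` {..<n}. p n \<in> en e} \<noteq> {e \<in> C. p n \<in> en e}" using deg by metis
    then obtain e where "e \<in> C" "e \<notin> q ` {..<n}" "p n \<in> en e" using t unfolding trail_def by blast
    then show False using stuck[OF t] by blast
  qed
  have "q ` {..<n} = C"
  proof (rule ccontr)
    assume ne: "q ` {..<n} \<noteq> C"
    have "0 < n"
    proof (rule ccontr)
      assume "\<not> 0 < n"
      obtain e where "e \<in> C" using assms(3) by blast
      moreover obtain a b where "en e = {a, b}" using two[OF \<open>e \<in> C\<close>] by (meson card_2_iff)
      ultimately show False
        using stuck[of "\<lambda>_. a" q e] \<open>\<not> 0 < n\<close> by (simp add: trail_def)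
    qed
    then have "q ` {..<n} \<noteq> {}" by auto
    moreover have "q ` {..<n} \<subseteq> C" using t by (simp add: trail_def)
    ultimately obtain e j z where e: "e \<in> C" "e \<notin> q ` {..<n}" "j < n" "z \<in> en e" "z \<in> en (q j)"
      using conn[of "q ` {..<n}"] ne by blast
    obtain k where k: "k < n" "z = p k"
    proof (cases "z = p j")
      case True
      then show ?thesis using that e(3) by blast
    next
      case False
      then have "z = p (Suc j)" using t e(3,5) by (auto simp: trail_def)
      then show ?thesis using that[of "Suc j"] that[of 0] closed e(3) \<open>0 < n\<close>
        by (cases "Suc j = n") auto
    qed
    show False
      by (rule stuck[OF trail_rotate(1)[OF t closed k(1)] e(1)])
         (use trail_rotate(2)[OF t closed k(1)] e(2,4) k in auto)
  qed
  then show ?thesis using t closed by blast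
qed

text \<open>With exactly two crossings, at steps \<open>k1\<close> and \<open>k2\<close>, the tour is on the other side precisely between
  them: the nodes in question have positions \<open>Suc k1\<close> to \<open>k2\<close>.\<close>

lemma closed_trail_crossed_twice:
  assumes t: "trail en C n p q" and k: "k1 < k2" "k2 < n"
    and cut: "\<And>k. k < n \<Longrightarrow> q k \<in> cut en C U \<longleftrightarrow> k = k1 \<or> k = k2"
    and "k \<le> n"
  shows "(p k \<in> U \<longleftrightarrow> p 0 \<in> U) \<longleftrightarrow> k \<notin> {Suc k1..k2}"
  using \<open>k \<le> n\<close>
proof (induction k)
  case 0
  then show ?case by simp
next
  case (Suc k)
  have "q k \<in> C" "en (q k) = {p k, p (Suc k)}" using t Suc.prems by (auto simp: trail_def)
  then have "(p k \<in> U) \<noteq> (p (Suc k) \<in> U) \<longleftrightarrow> q k \<in> cut en C U" by (auto simp: cut_def)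
  then have "(p (Suc k) \<in> U \<longleftrightarrow> p k \<in> U) \<longleftrightarrow> k \<noteq> k1 \<and> k \<noteq> k2"
    using cut[of k] Suc.prems by auto
  moreover have "(p k \<in> U \<longleftrightarrow> p 0 \<in> U) \<longleftrightarrow> k \<notin> {Suc k1..k2}" using Suc by simp
  ultimately show ?case using k by (auto simp: le_Suc_eq)
qed

lemma spath_imp_reach: "spath en A u N P v \<Longrightarrow> reach en P u v"
proof (induction rule: spath.induct)
  case spath_refl
  then show ?case by simp
next
  case (spath_step N P v e z)
  have "reach en (insert e P) u v" using spath_step.IH by (rule reach_mono[rotated]) auto
  moreover have "reach en (insert e P) v z" using spath_step.hyps(3) by (intro reach_edge) auto
  ultimately show ?case by (rule reach_trans)
qed

lemma spath_remove_edge: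
  "spath en A u N P v \<Longrightarrow> e' \<in> P \<Longrightarrow>
    \<exists>a b. en e' = {a, b} \<and> reach en (P - {e'}) u a \<and> reach en (P - {e'}) b v"
proof (induction rule: spath.induct)
  case spath_refl
  then show ?case by simp
next
  case (spath_step N P v e z)
  have "e \<notin> P" using spath_nodes(5)[OF spath_step.hyps(1), of e] spath_step.hyps(3,4) by auto
  show ?case
  proof (cases "e' = e")
    case True
    then have "insert e P - {e'} = P" using \<open>e \<notin> P\<close> by auto
    then show ?thesis
      using spath_imp_reach[OF spath_step.hyps(1)] spath_step.hyps(3) True
      by (intro exI[of _ v] exI[of _ z]) simp
  next
    case False
    then obtain a b where ab: "en e' = {a, b}" "reach en (P - {e'}) u a" "reach en (P - {e'}) b v"
      using spath_step.IH spath_step.prems by auto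
    have sub: "P - {e'} \<subseteq> insert e P - {e'}" by auto
    have "reach en (insert e P - {e'}) v z"
      using False spath_step.hyps(3) by (intro reach_edge[of e]) auto
    then have "reach en (insert e P - {e'}) b z" by (rule reach_trans[OF reach_mono[OF sub ab(3)]])
    then show ?thesis using ab(1) reach_mono[OF sub ab(2)] by blast
  qed
qed

text \<open>The negation of being a bridge, in the form that directly yields a cycle: \<open>e\<close> and a path avoiding it.\<close>

definition on_cycle :: "('e \<Rightarrow> 'v set) \<Rightarrow> 'e set \<Rightarrow> 'e \<Rightarrow> bool" where
  "on_cycle en H e \<longleftrightarrow> (\<exists>u v. en e = {u, v} \<and> reach en (H - {e}) u v)"

lemma on_cycle_mono: "H \<subseteq> K \<Longrightarrow> on_cycle en H e \<Longrightarrow> on_cycle en K e"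
  unfolding on_cycle_def by (elim exE conjE, intro exI conjI, assumption, rule reach_mono) auto

text \<open>Removing an edge from a cycle leaves a path, which runs around the other way.\<close>

lemma cycle_edges_on_cycle:
  assumes p: "spath en (H - {e}) u N P v" and e: "en e = {u, v}" "e \<in> H" and e': "e' \<in> insert e P"
  shows "on_cycle en H e'"
proof -
  have P: "P \<subseteq> H - {e}" using spath_nodes(3)[OF p] .
  show ?thesis
  proof (cases "e' = e")
    case True
    have "reach en (H - {e}) u v" using spath_imp_reach[OF p] by (rule reach_mono[OF P])
    then show ?thesis using e(1) True unfolding on_cycle_def by blast
  next
    case False
    then have "e' \<in> P" using e' by simp
    from spath_remove_edge[OF p this] obtain a b where
      ab: "en e' = {a, b}" "reach en (P - {e'}) u a" "reach en (P - {e'}) b v" by blast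
    have sub: "P - {e'} \<subseteq> H - {e'}" using P by auto
    have "reach en (H - {e'}) u v" by (rule reach_edge[of e]) (use False e in auto)
    then have "reach en (H - {e'}) a v" by (rule reach_trans[OF reach_sym[OF reach_mono[OF sub ab(2)]]])
    then have "reach en (H - {e'}) a b" by (rule reach_trans[OF _ reach_sym[OF reach_mono[OF sub ab(3)]]])
    then show ?thesis using ab(1) unfolding on_cycle_def by blast
  qed
qed

lemma connected_component_of_components:
  "C \<in> components S \<Longrightarrow> a \<in> C \<Longrightarrow> b \<in> C \<Longrightarrow> connected_component S a b"
  by (rule connected_componentI[OF in_components_connected in_components_subset])

lemma components_joined_eq:
  assumes "C \<in> components S" "C' \<in> components S" "a \<in> C" "b \<in> C'" "connected_component S a b"
  shows "C = C'"
proof -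
  obtain T where T: "connected T" "T \<subseteq> S" "a \<in> T" "b \<in> T"
    using assms(5) unfolding connected_component_def by blast
  have "T \<subseteq> C" by (rule components_maximal[OF assms(1) T(1,2)]) (use T(3) assms(3) in blast)
  then show ?thesis using components_eq[OF assms(1,2)] T(4) assms(4) by blast
qed

lemma trail_uncrossed:
  assumes t: "trail en C n p q" and none: "\<And>k. k < n \<Longrightarrow> q k \<notin> cut en C U" and "k \<le> n"
  shows "p k \<in> U \<longleftrightarrow> p 0 \<in> U"
  using \<open>k \<le> n\<close>
proof (induction k)
  case 0
  then show ?case by simp
next
  case (Suc k)
  have "q k \<in> C" "en (q k) = {p k, p (Suc k)}" using t Suc.prems by (auto simp: trail_def)
  then have "p k \<in> U \<longleftrightarrow> p (Suc k) \<in> U" using none[of k] Suc.prems by (auto simp: cut_def)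
  then show ?case using Suc by simp
qed

text \<open>A cut \<open>F\<close> whose two sides, \<open>U\<close> being one of them, are connected; if nonempty, it is minimal.\<close>

definition bond :: "('e \<Rightarrow> 'v set) \<Rightarrow> 'e set \<Rightarrow> 'v set \<Rightarrow> 'e set \<Rightarrow> bool" where
  "bond en X U F \<longleftrightarrow> F = cut en X U \<and>
     (\<forall>u\<in>\<Union>(en ` X). \<forall>v\<in>\<Union>(en ` X). (u \<in> U \<longleftrightarrow> v \<in> U) \<longrightarrow> reach en (X - F) u v)"

definition splits :: "'v set \<Rightarrow> 'v set \<Rightarrow> bool" where
  "splits U p \<longleftrightarrow> p \<inter> U \<noteq> {} \<and> p - U \<noteq> {}"

text \<open>Two edges of a bond close a cycle through its two connected sides.\<close>

lemma bond_edge_on_cycle: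
  assumes bond: "bond en X U F" and e: "e \<in> F" "e2 \<in> F" "e2 \<noteq> e"
    and two: "card (en e) = 2" "card (en e2) = 2" and Y: "X - F \<subseteq> Y" "e2 \<in> Y"
  shows "on_cycle en Y e"
proof -
  have F: "F = cut en X U" using bond by (simp only: bond_def)
  have conn: "reach en (Y - {e}) u v"
    if uv: "u \<in> \<Union>(en ` X)" "v \<in> \<Union>(en ` X)" and eq: "u \<in> U \<longleftrightarrow> v \<in> U" for u v
  proof -
    have "\<forall>u\<in>\<Union>(en ` X). \<forall>v\<in>\<Union>(en ` X). (u \<in> U \<longleftrightarrow> v \<in> U) \<longrightarrow> reach en (X - F) u v"
      using bond unfolding bond_def by (rule conjunct2)
    from bspec[OF bspec[OF this uv(1)] uv(2)] eq have "reach en (X - F) u v" by (rule mp)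
    moreover have "X - F \<subseteq> Y - {e}" using Y(1) e(1) by blast
    ultimately show ?thesis using reach_mono by metis
  qed
  have ends: "\<exists>a b. en e' = {a, b} \<and> a \<in> U \<and> b \<notin> U \<and> a \<in> \<Union>(en ` X) \<and> b \<in> \<Union>(en ` X)"
    if e': "e' \<in> F" "card (en e') = 2" for e'
  proof -
    obtain c d where cd: "en e' = {c, d}" using e'(2) by (meson card_2_iff)
    have "e' \<in> cut en X U" using e'(1) F by simp
    then have "e' \<in> X" "c \<in> U \<and> d \<notin> U \<or> d \<in> U \<and> c \<notin> U" by (auto simp: cut_def cd)
    moreover have "en e' \<subseteq> \<Union>(en ` X)" using calculation(1) by blast
    ultimately show ?thesis using cd by (auto simp: insert_commute)
  qed
  obtain a b where ab: "en e = {a, b}" "a \<in> U" "b \<notin> U" "a \<in> \<Union>(en ` X)" "b \<in> \<Union>(en ` X)"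
    using ends[OF e(1) two(1)] by (elim exE conjE) (rule that)
  obtain c d where cd: "en e2 = {c, d}" "c \<in> U" "d \<notin> U" "c \<in> \<Union>(en ` X)" "d \<in> \<Union>(en ` X)"
    using ends[OF e(2) two(2)] by (elim exE conjE) (rule that)
  have "reach en (Y - {e}) a c" using conn[OF ab(4) cd(4)] ab(2) cd(2) by simp
  also have "reach en (Y - {e}) c d"
    by (rule reach_edge[of e2 _ en c d, OF _ cd(1)]) (use e(3) Y(2) in simp)
  also have "reach en (Y - {e}) d b" using conn[OF cd(5) ab(5)] ab(3) cd(3) by simp
  finally show ?thesis using ab(1) unfolding on_cycle_def by blast
qed

section \<open>Faces and cycles of a plane graph\<close>

text \<open>A loopless plane graph without isolated nodes. All statements about its subgraphs are made for edge
  sets \<open>H \<subseteq> X\<close>, since the proofs delete edges.\<close>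

locale plane_graph =
  fixes X :: "'e set" and en :: "'e \<Rightarrow> 'v set"
    and pos :: "'v \<Rightarrow> complex" and crv :: "'e \<Rightarrow> real \<Rightarrow> complex"
  assumes finite_X: "finite X"
    and card_en: "e \<in> X \<Longrightarrow> card (en e) = 2"
    and arc_crv: "e \<in> X \<Longrightarrow> arc (crv e)"
    and crv_ends: "e \<in> X \<Longrightarrow> {pathstart (crv e), pathfinish (crv e)} = pos ` en e"
    and inj_pos: "inj_on pos (\<Union>e\<in>X. en e)"
    and crv_meet: "e \<in> X \<Longrightarrow> e' \<in> X \<Longrightarrow> e \<noteq> e' \<Longrightarrow>
      path_image (crv e) \<inter> path_image (crv e') = pos ` (en e \<inter> en e')"
begin

abbreviation img :: "'e \<Rightarrow> complex set" where "img e \<equiv> path_image (crv e)"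

definition inner :: "'e \<Rightarrow> complex set" where "inner e = img e - pos ` en e"

lemma ends_in_img: "e \<in> X \<Longrightarrow> pos ` en e \<subseteq> img e"
  by (simp add: crv_ends[symmetric] pathstart_in_path_image pathfinish_in_path_image)

lemma inner_eq: "e \<in> X \<Longrightarrow> inner e = crv e ` {0<..<1}"
  unfolding inner_def crv_ends[symmetric] by (simp add: simple_path_endless arc_crv arc_imp_simple_path)

lemma connected_inner: "e \<in> X \<Longrightarrow> connected (inner e)"
  unfolding inner_def crv_ends[symmetric]
  by (intro connected_simple_path_endless arc_imp_simple_path arc_crv)

lemma inner_nonempty: "e \<in> X \<Longrightarrow> inner e \<noteq> {}"
  by (simp add: inner_eq)

text \<open>A face that comes close to all inner points of an edge thus comes close to its ends as well.\<close>

lemma img_subset_closure_inner: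
  assumes "e \<in> X"
  shows "img e \<subseteq> closure (inner e)"
proof -
  have "crv e ` closure {0<..<1} \<subseteq> closure (crv e ` {0<..<1})"
  proof (rule image_closure_subset)
    show "continuous_on (closure {0<..<1}) (crv e)"
      using arc_imp_path[OF arc_crv[OF assms]] by (simp add: path_def)
  qed (auto simp: closure_subset)
  then show ?thesis using assms by (simp add: inner_eq path_image_def)
qed

lemma compact_img: "e \<in> X \<Longrightarrow> compact (img e)"
  by (simp add: compact_path_image arc_imp_path arc_crv)

lemma compact_drawing: "H \<subseteq> X \<Longrightarrow> compact (drawing crv H)"
  unfolding drawing_def using finite_subset[OF _ finite_X] compact_img by (auto intro!: compact_UN)

lemma closed_drawing: "H \<subseteq> X \<Longrightarrow> closed (drawing crv H)"
  by (simp add: compact_drawing compact_imp_closed)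

lemma open_face: "H \<subseteq> X \<Longrightarrow> \<psi> \<in> faces crv H \<Longrightarrow> open \<psi>"
  unfolding faces_def by (rule open_components) (auto simp: closed_drawing)

lemma face_disjoint_drawing: "\<psi> \<in> faces crv H \<Longrightarrow> \<psi> \<inter> drawing crv H = {}"
  unfolding faces_def using in_components_subset by blast

lemma face_connected: "\<psi> \<in> faces crv H \<Longrightarrow> connected \<psi>"
  unfolding faces_def by (rule in_components_connected)

lemma face_nonempty: "\<psi> \<in> faces crv H \<Longrightarrow> \<psi> \<noteq> {}"
  unfolding faces_def by (rule in_components_nonempty)

lemma drawing_insert: "drawing crv (insert e H) = img e \<union> drawing crv H"
  by (simp add: drawing_def)

lemma drawing_mono: "H \<subseteq> K \<Longrightarrow> drawing crv H \<subseteq> drawing crv K"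
  by (auto simp: drawing_def)

lemma img_subset_drawing: "e \<in> H \<Longrightarrow> img e \<subseteq> drawing crv H"
  by (auto simp: drawing_def)

lemma inner_disjoint_img: "e \<in> X \<Longrightarrow> e' \<in> X \<Longrightarrow> e \<noteq> e' \<Longrightarrow> inner e \<inter> img e' = {}"
  using crv_meet[of e e'] by (auto simp: inner_def)

lemma inner_disjoint_drawing:
  "e \<in> X \<Longrightarrow> H \<subseteq> X \<Longrightarrow> e \<notin> H \<Longrightarrow> inner e \<inter> drawing crv H = {}"
  unfolding drawing_def using inner_disjoint_img by blast

text \<open>An edge passes through a node only if it ends there: the node is an end of some other edge, and two
  edges meet only in common ends.\<close>

lemma node_in_img:
  assumes "e \<in> X" "e' \<in> X" "v \<in> en e'" "pos v \<in> img e"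
  shows "v \<in> en e"
proof (cases "e = e'")
  case False
  have "pos v \<in> img e'" using ends_in_img assms(2,3) by blast
  then have "pos v \<in> pos ` (en e \<inter> en e')" using crv_meet[OF assms(1,2) False] assms(4) by blast
  then obtain y where "y \<in> en e" "pos y = pos v" by auto
  then have "y = v" using inj_onD[OF inj_pos] assms(1-3) by blast
  then show ?thesis using \<open>y \<in> en e\<close> by simp
qed (use assms in simp)

lemma face_coarser:
  assumes "H \<subseteq> K" "\<psi> \<in> faces crv K"
  shows "\<exists>\<phi>\<in>faces crv H. \<psi> \<subseteq> \<phi>"
proof -
  have "\<psi> \<subseteq> - drawing crv H" using face_disjoint_drawing[OF assms(2)] drawing_mono[OF assms(1)] by blast
  moreover have "- drawing crv H \<noteq> {}" using calculation face_nonempty[OF assms(2)] by blast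
  ultimately show ?thesis
    unfolding faces_def using exists_component_superset face_connected[OF assms(2)] by metis
qed

lemma faces_eq_if_meet: "\<psi> \<in> faces crv H \<Longrightarrow> \<phi> \<in> faces crv H \<Longrightarrow> \<psi> \<inter> \<phi> \<noteq> {} \<Longrightarrow> \<psi> = \<phi>"
  unfolding faces_def using components_eq by blast

lemma oriented_edge_arc:
  assumes "e \<in> X" "en e = {v, z}"
  shows "\<exists>h. arc h \<and> pathstart h = pos v \<and> pathfinish h = pos z \<and> path_image h = img e"
proof (cases "pathstart (crv e) = pos v")
  case True
  have "pathfinish (crv e) \<noteq> pos v" using arc_distinct_ends[OF arc_crv[OF assms(1)]] True by simp
  then have "pathfinish (crv e) = pos z" using crv_ends[OF assms(1)] assms(2) by auto
  then show ?thesis using True arc_crv[OF assms(1)] by blast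
next
  case False
  then have s: "pathstart (crv e) = pos z" using crv_ends[OF assms(1)] assms(2) by auto
  then have "pathfinish (crv e) = pos v"
    using crv_ends[OF assms(1)] assms(2) False by (auto simp: doubleton_eq_iff)
  then show ?thesis
    using s arc_crv[OF assms(1)] by (intro exI[of _ "reversepath (crv e)"]) (simp add: arc_reversepath)
qed

lemma spath_arc:
  assumes "spath en A u N P v" "A \<subseteq> X"
  shows "P = {} \<and> u = v \<or>
    (\<exists>g. arc g \<and> pathstart g = pos u \<and> pathfinish g = pos v \<and> path_image g = drawing crv P)"
  using assms(1)
proof (induction rule: spath.induct)
  case spath_refl
  then show ?case by simp
next
  case (spath_step N P v e z)
  have eX: "e \<in> X" using spath_step.hyps(2) assms(2) by blast
  obtain h where h: "arc h" "pathstart h = pos v" "pathfinish h = pos z" "path_image h = img e"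
    using oriented_edge_arc[OF eX spath_step.hyps(3)] by blast
  from spath_step.IH show ?case
  proof
    assume "P = {} \<and> u = v"
    then show ?thesis using h by (intro disjI2 exI[of _ h]) (auto simp: drawing_def)
  next
    assume "\<exists>g. arc g \<and> pathstart g = pos u \<and> pathfinish g = pos v \<and> path_image g = drawing crv P"
    then obtain g where g: "arc g" "pathstart g = pos u" "pathfinish g = pos v"
      "path_image g = drawing crv P" by blast
    have "drawing crv P \<inter> img e \<subseteq> {pos v}"
    proof
      fix x assume x: "x \<in> drawing crv P \<inter> img e"
      then obtain e' where e': "e' \<in> P" "x \<in> img e'" by (auto simp: drawing_def)
      have "en e' \<subseteq> N" using spath_nodes(5)[OF spath_step.hyps(1) e'(1)] .
      then have "en e' \<inter> en e \<subseteq> {v}" "e' \<noteq> e" using spath_step.hyps(3,4) by auto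
      moreover have "e' \<in> X" using e'(1) spath_nodes(3)[OF spath_step.hyps(1)] assms(2) by blast
      ultimately show "x \<in> {pos v}" using crv_meet[of e' e] eX e'(2) x by blast
    qed
    then have "arc (g +++ h)" using g h by (intro arc_join) auto
    moreover have "path_image (g +++ h) = drawing crv (insert e P)"
      using g h by (simp add: path_image_join drawing_insert Un_commute)
    ultimately show ?thesis using g h by (intro disjI2 exI[of _ "g +++ h"]) auto
  qed
qed

text \<open>The path and the edge \<open>e\<close> that closes it are drawn as a Jordan curve.\<close>

lemma cycle_simple_closed_curve:
  assumes H: "H \<subseteq> X" "e \<in> H" and p: "spath en (H - {e}) u N P v" and e: "en e = {u, v}"
  shows "\<exists>c. simple_path c \<and> pathfinish c = pathstart c \<and> path_image c = drawing crv (insert e P)"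
    and "connected (drawing crv P)" and "pos ` en e \<subseteq> drawing crv P"
proof -
  have eX: "e \<in> X" using H by blast
  have "u \<noteq> v" using card_en[OF eX] e by (auto simp: card_insert_if)
  then obtain g where g: "arc g" "pathstart g = pos u" "pathfinish g = pos v"
      "path_image g = drawing crv P"
    using spath_arc[OF p] H(1) by blast
  show "connected (drawing crv P)" using g by (metis arc_imp_path connected_path_image)
  show ends: "pos ` en e \<subseteq> drawing crv P"
    using g(2-4) pathstart_in_path_image[of g] pathfinish_in_path_image[of g] e by auto
  obtain h where h: "arc h" "pathstart h = pos v" "pathfinish h = pos u" "path_image h = img e"
    using oriented_edge_arc[OF eX, of v u] e by (auto simp: insert_commute)
  have "P \<subseteq> X" "e \<notin> P" using spath_nodes(3)[OF p] H(1) by auto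
  then have "drawing crv P \<inter> img e \<subseteq> {pos u, pos v}"
    using inner_disjoint_drawing[OF eX, of P] e by (auto simp: inner_def)
  then have "simple_path (g +++ h)" using g h by (intro simple_path_join_loop) auto
  moreover have "path_image (g +++ h) = drawing crv (insert e P)"
    using g h by (simp add: path_image_join drawing_insert Un_commute)
  ultimately show "\<exists>c. simple_path c \<and> pathfinish c = pathstart c \<and> path_image c = drawing crv (insert e P)"
    using g h by (intro exI[of _ "g +++ h"]) simp
qed

text \<open>The step behind the fact that an edge has only two sides. The Jordan curve \<open>J\<close> through \<open>e\<close> and the
  rest \<open>R\<close> of the drawing intersect in the path that closes the cycle, which is connected. So by
  Janiszewski's theorem two points are separated by \<open>J \<union> R\<close> only if they are separated by \<open>J\<close> or by
  \<open>R\<close>: the part of the face \<open>f\<close> around \<open>e\<close> on one side of \<open>J\<close> is a single face.\<close>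

lemma face_on_one_side:
  assumes H: "H \<subseteq> X" "e \<in> H" and p: "spath en (H - {e}) u N P v" "en e = {u, v}"
    and f: "f \<in> faces crv (H - {e})" "inner e \<subseteq> f"
    and S: "open S" "connected S" "frontier S = drawing crv (insert e P)"
  shows "S \<inter> f \<in> faces crv H" "inner e \<subseteq> closure (S \<inter> f)"
proof -
  let ?J = "drawing crv (insert e P)" and ?R = "drawing crv (H - {e})"
  have eX: "e \<in> X" using H by blast
  have P: "P \<subseteq> H - {e}" using spath_nodes(3)[OF p(1)] .
  have R: "H - {e} \<subseteq> X" using H by auto
  have D: "drawing crv H = ?J \<union> ?R" using P H(2) by (auto simp: drawing_def)
  have SJ: "S \<inter> ?J = {}" using S(1,3) frontier_disjoint_eq by auto
  show near: "inner e \<subseteq> closure (S \<inter> f)"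
  proof
    fix x assume x: "x \<in> inner e"
    then have "x \<in> closure S" using S(3) by (auto simp: drawing_insert inner_def frontier_def)
    then have "x \<in> closure (f \<inter> S)"
      using open_Int_closure_subset[OF open_face[OF R f(1)]] f(2) x by blast
    then show "x \<in> closure (S \<inter> f)" by (simp add: Int_commute)
  qed
  then have "S \<inter> f \<noteq> {}" using inner_nonempty[OF eX] by auto
  then obtain a where a: "a \<in> S \<inter> f" by blast
  have JR: "?J \<inter> ?R = drawing crv P"
  proof -
    have "img e \<inter> ?R \<subseteq> pos ` en e"
      using inner_disjoint_drawing[OF eX R] by (auto simp: inner_def)
    then have "img e \<inter> ?R \<subseteq> drawing crv P" using cycle_simple_closed_curve(3)[OF H p] by blast
    then show ?thesis using drawing_mono[OF P] by (auto simp: drawing_insert)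
  qed
  have PX: "insert e P \<subseteq> X" using P R eX by blast
  have near_comp: "connected_component (- drawing crv H) a b" if "b \<in> S \<inter> f" for b
    unfolding D
  proof (rule Janiszewski)
    show "compact ?J" by (rule compact_drawing[OF PX])
    show "closed ?R" by (rule closed_drawing[OF R])
    show "connected (?J \<inter> ?R)" unfolding JR by (rule cycle_simple_closed_curve(2)[OF H p])
    show "connected_component (- ?J) a b"
      by (rule connected_componentI[OF S(2)]) (use SJ a that in auto)
    show "connected_component (- ?R) a b"
      using connected_component_of_components f(1) a that unfolding faces_def by blast
  qed
  define C where "C = connected_component_set (- drawing crv H) a"
  have "a \<in> - drawing crv H" using near_comp[OF a] connected_component_in by blast
  then have C: "C \<in> components (- drawing crv H)" "a \<in> C"
    by (auto simp: C_def components_def)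
  have "C \<subseteq> f"
  proof (rule components_maximal)
    show "f \<in> components (- ?R)" using f(1) by (simp add: faces_def)
    show "connected C" using C(1) by (rule in_components_connected)
    show "C \<subseteq> - ?R" using in_components_subset[OF C(1)] D by blast
    show "f \<inter> C \<noteq> {}" using a C(2) by blast
  qed
  moreover have "C \<subseteq> S"
  proof (rule ccontr)
    assume "\<not> C \<subseteq> S"
    then have "C \<inter> frontier S \<noteq> {}"
      using connected_Int_frontier[OF in_components_connected[OF C(1)], of S] a C(2) by blast
    then show False using in_components_subset[OF C(1)] D S(3) by blast
  qed
  moreover have "S \<inter> f \<subseteq> C" using near_comp by (auto simp: C_def)
  ultimately have "C = S \<inter> f" by blast
  then show "S \<inter> f \<in> faces crv H" using C(1) by (simp add: faces_def)
qed

lemma face_around_inner: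
  assumes "H \<subseteq> X" "e \<in> H"
  shows "\<exists>f\<in>faces crv (H - {e}). inner e \<subseteq> f"
proof -
  have eX: "e \<in> X" using assms by blast
  have "H - {e} \<subseteq> X" using assms(1) by blast
  from inner_disjoint_drawing[OF eX this] have "inner e \<subseteq> - drawing crv (H - {e})" by blast
  moreover have "- drawing crv (H - {e}) \<noteq> {}" using calculation inner_nonempty[OF eX] by blast
  ultimately show ?thesis
    unfolding faces_def using exists_component_superset connected_inner[OF eX] by metis
qed

text \<open>Adding the edge \<open>e\<close> to \<open>H - {e}\<close> cuts the face around it into two, one on each side of the cycle, and
  leaves all other faces unchanged.\<close>

lemma cycle_edge_splits_face:
  assumes H: "H \<subseteq> X" "e \<in> H" and p: "spath en (H - {e}) u N P v" "en e = {u, v}"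
  obtains f I W where "f \<in> faces crv (H - {e})" "inner e \<subseteq> f"
    "open I" "open W" "I \<inter> W = {}" "I \<union> W = - drawing crv (insert e P)"
    "frontier I = drawing crv (insert e P)" "frontier W = drawing crv (insert e P)"
    "I \<inter> f \<in> faces crv H" "W \<inter> f \<in> faces crv H"
    "inner e \<subseteq> closure (I \<inter> f)" "inner e \<subseteq> closure (W \<inter> f)"
    "faces crv H = faces crv (H - {e}) - {f} \<union> {I \<inter> f, W \<inter> f}"
proof -
  let ?J = "drawing crv (insert e P)"
  have eX: "e \<in> X" using H by blast
  have R: "H - {e} \<subseteq> X" using H by auto
  obtain c where c: "simple_path c" "pathfinish c = pathstart c" "path_image c = ?J"
    using cycle_simple_closed_curve(1)[OF H p] by (elim exE conjE) (rule that)
  define I where "I = inside ?J"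
  define W where "W = outside ?J"
  have IO: "open I" "connected I" "open W" "connected W" "I \<inter> W = {}" "I \<union> W = - ?J"
    "frontier I = ?J" "frontier W = ?J"
    by (simp_all only: Jordan_inside_outside[OF c(1,2), unfolded c(3), folded I_def W_def])
  obtain f where f: "f \<in> faces crv (H - {e})" "inner e \<subseteq> f" using face_around_inner[OF H] by blast
  note I = face_on_one_side[OF H p f IO(1,2,7)] and W = face_on_one_side[OF H p f IO(3,4,8)]
  have D: "drawing crv H = img e \<union> drawing crv (H - {e})"
    using H(2) by (auto simp: drawing_def)
  have other: "g \<in> faces crv H" if g: "g \<in> faces crv (H - {e})" "g \<noteq> f" for g
  proof -
    have "g \<inter> f = {}" using faces_eq_if_meet[OF g(1) f(1)] g(2) by blast
    then have "g \<inter> inner e = {}" using f(2) by blast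
    moreover have "pos ` en e \<subseteq> drawing crv (H - {e})"
      by (rule subset_trans[OF cycle_simple_closed_curve(3)[OF H p] drawing_mono[OF spath_nodes(3)[OF p(1)]]])
    moreover note face_disjoint_drawing[OF g(1)]
    ultimately have "g \<inter> drawing crv H = {}"
      unfolding D inner_def by blast
    then have "g \<subseteq> - drawing crv H" by blast
    moreover have "- drawing crv H \<subseteq> - drawing crv (H - {e})" using D by blast
    ultimately show ?thesis
      using g(1) components_intermediate_subset unfolding faces_def by metis
  qed
  have "faces crv H \<subseteq> faces crv (H - {e}) - {f} \<union> {I \<inter> f, W \<inter> f}"
  proof
    fix \<psi> assume \<psi>: "\<psi> \<in> faces crv H"
    have "H - {e} \<subseteq> H" by blast
    from face_coarser[OF this \<psi>] obtain g where g: "g \<in> faces crv (H - {e})" "\<psi> \<subseteq> g"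
      by (elim bexE) (rule that)
    obtain a where a: "a \<in> \<psi>" using face_nonempty[OF \<psi>] by blast
    have "insert e P \<subseteq> H" using spath_nodes(3)[OF p(1)] H(2) by auto
    from drawing_mono[OF this] have aJ: "a \<notin> ?J" using a face_disjoint_drawing[OF \<psi>] by blast
    then have aIW: "a \<in> I \<or> a \<in> W" using IO(6) by auto
    have ag: "a \<in> g" using a g(2) by blast
    show "\<psi> \<in> faces crv (H - {e}) - {f} \<union> {I \<inter> f, W \<inter> f}"
    proof (cases "g = f")
      case True
      from aIW show ?thesis
      proof
        assume "a \<in> I"
        then have "\<psi> \<inter> (I \<inter> f) \<noteq> {}" using a ag True by blast
        from faces_eq_if_meet[OF \<psi> I(1) this] show ?thesis by simp
      next
        assume "a \<in> W"
        then have "\<psi> \<inter> (W \<inter> f) \<noteq> {}" using a ag True by blast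
        from faces_eq_if_meet[OF \<psi> W(1) this] show ?thesis by simp
      qed
    next
      case False
      have "\<psi> \<inter> g \<noteq> {}" using a ag by blast
      from faces_eq_if_meet[OF \<psi> other[OF g(1) False] this] show ?thesis using g(1) False by simp
    qed
  qed
  moreover have "faces crv (H - {e}) - {f} \<union> {I \<inter> f, W \<inter> f} \<subseteq> faces crv H"
  proof
    fix g assume "g \<in> faces crv (H - {e}) - {f} \<union> {I \<inter> f, W \<inter> f}"
    then consider "g \<in> faces crv (H - {e})" "g \<noteq> f" | "g = I \<inter> f" | "g = W \<inter> f" by blast
    then show "g \<in> faces crv H" by cases (simp_all add: other I(1) W(1))
  qed
  ultimately have eq: "faces crv H = faces crv (H - {e}) - {f} \<union> {I \<inter> f, W \<inter> f}"
    by (rule equalityI)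
  show thesis
    by (rule that[of f I W]) (fact f IO I W eq)+
qed

end

lemma on_cycle_spath:
  assumes "on_cycle en H e"
  obtains u v N P where "spath en (H - {e}) u N P v" "en e = {u, v}"
proof -
  obtain u v where uv: "en e = {u, v}" "reach en (H - {e}) u v"
    using assms unfolding on_cycle_def by blast
  obtain N P where "spath en (H - {e}) u N P v" using reach_imp_spath[OF uv(2)] by blast
  then show ?thesis by (rule that) (rule uv(1))
qed

context plane_graph
begin

text \<open>A face that only touches an end of \<open>e\<close> does not count. Asking for a single inner point is easy to verify,
  and if \<open>e\<close> is on a cycle, then all of \<open>e\<close> lies in the closure of the face (\<open>borders_closure\<close>).\<close>

definition borders :: "'e \<Rightarrow> complex set \<Rightarrow> bool" where
  "borders e \<psi> \<longleftrightarrow> inner e \<inter> closure \<psi> \<noteq> {}"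

text \<open>Bridges are left out: they border one face only, from both sides, so that modulo 2 they do not belong
  to its boundary.\<close>

definition boundary :: "'e set \<Rightarrow> complex set \<Rightarrow> 'e set" where
  "boundary H \<psi> = {e \<in> H. on_cycle en H e \<and> borders e \<psi>}"

lemma borders_mono: "\<psi> \<subseteq> \<phi> \<Longrightarrow> borders e \<psi> \<Longrightarrow> borders e \<phi>"
  unfolding borders_def using closure_mono[of \<psi> \<phi>] by blast

lemma bordering_face_meets:
  "borders e \<psi> \<Longrightarrow> open W \<Longrightarrow> inner e \<subseteq> W \<Longrightarrow> \<psi> \<inter> W \<noteq> {}"
  unfolding borders_def using open_Int_closure_eq_empty[of W \<psi>] by blast

lemma bordering_face_subset:
  assumes "H \<subseteq> X" "\<psi> \<in> faces crv H" "borders e \<psi>" "f \<in> faces crv (H - {e})" "inner e \<subseteq> f"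
  shows "\<psi> \<subseteq> f"
proof -
  obtain g where g: "g \<in> faces crv (H - {e})" "\<psi> \<subseteq> g" using face_coarser[OF _ assms(2)] by blast
  have "H - {e} \<subseteq> X" using assms(1) by blast
  from bordering_face_meets[OF assms(3) open_face[OF this assms(4)] assms(5)]
  have "g \<inter> f \<noteq> {}" using g(2) by blast
  from faces_eq_if_meet[OF g(1) assms(4) this] show ?thesis using g(2) by simp
qed

lemma two_bordering_faces:
  assumes H: "H \<subseteq> X" "e \<in> H" and p: "spath en (H - {e}) u N P v" "en e = {u, v}"
  obtains f I W where "f \<in> faces crv (H - {e})" "inner e \<subseteq> f" "I \<inter> f \<noteq> W \<inter> f"
    "open I" "open W" "I \<inter> W = {}" "I \<union> W = - drawing crv (insert e P)"
    "frontier I = drawing crv (insert e P)" "frontier W = drawing crv (insert e P)"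
    "inner e \<subseteq> closure (I \<inter> f)" "inner e \<subseteq> closure (W \<inter> f)"
    "faces crv H = faces crv (H - {e}) - {f} \<union> {I \<inter> f, W \<inter> f}"
    "{\<psi> \<in> faces crv H. borders e \<psi>} = {I \<inter> f, W \<inter> f}"
proof -
  from cycle_edge_splits_face[OF H p] obtain f I W where
    f: "f \<in> faces crv (H - {e})" "inner e \<subseteq> f" and
    IW: "open I" "open W" "I \<inter> W = {}" "I \<union> W = - drawing crv (insert e P)"
    "frontier I = drawing crv (insert e P)" "frontier W = drawing crv (insert e P)" and
    faces: "I \<inter> f \<in> faces crv H" "W \<inter> f \<in> faces crv H" and
    near: "inner e \<subseteq> closure (I \<inter> f)" "inner e \<subseteq> closure (W \<inter> f)" and
    eq: "faces crv H = faces crv (H - {e}) - {f} \<union> {I \<inter> f, W \<inter> f}" .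
  have eX: "e \<in> X" using H by blast
  have ne: "I \<inter> f \<noteq> W \<inter> f" using face_nonempty[OF faces(1)] IW(3) by blast
  have "borders e (I \<inter> f)" "borders e (W \<inter> f)"
    using near inner_nonempty[OF eX] unfolding borders_def by blast+
  moreover have "\<psi> \<in> {I \<inter> f, W \<inter> f}" if \<psi>: "\<psi> \<in> faces crv H" "borders e \<psi>" for \<psi>
  proof (rule ccontr)
    assume "\<psi> \<notin> {I \<inter> f, W \<inter> f}"
    then have g: "\<psi> \<in> faces crv (H - {e})" "\<psi> \<noteq> f" using \<psi>(1) unfolding eq by auto
    have "\<psi> \<subseteq> f" by (rule bordering_face_subset[OF H(1) \<psi> f])
    then have "\<psi> \<inter> f \<noteq> {}" using face_nonempty[OF \<psi>(1)] by blast
    from faces_eq_if_meet[OF g(1) f(1) this] g(2) show False by simp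
  qed
  ultimately have "{\<psi> \<in> faces crv H. borders e \<psi>} = {I \<inter> f, W \<inter> f}" using faces by auto
  then show ?thesis by (rule that[OF f ne IW near eq])
qed

lemma card_bordering_faces:
  assumes "H \<subseteq> X" "e \<in> H" "on_cycle en H e"
  shows "finite {\<psi> \<in> faces crv H. borders e \<psi>}" "card {\<psi> \<in> faces crv H. borders e \<psi>} = 2"
proof -
  obtain u v N P where p: "spath en (H - {e}) u N P v" "en e = {u, v}"
    using on_cycle_spath[OF assms(3)] .
  obtain f I W where "I \<inter> f \<noteq> W \<inter> f" "{\<psi> \<in> faces crv H. borders e \<psi>} = {I \<inter> f, W \<inter> f}"
    by (rule two_bordering_faces[OF assms(1,2) p])
  then show "finite {\<psi> \<in> faces crv H. borders e \<psi>}" "card {\<psi> \<in> faces crv H. borders e \<psi>} = 2"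
    by simp_all
qed

lemma borders_closure:
  assumes "H \<subseteq> X" "e \<in> H" "on_cycle en H e" "\<psi> \<in> faces crv H" "borders e \<psi>"
  shows "img e \<subseteq> closure \<psi>"
proof -
  obtain u v N P where p: "spath en (H - {e}) u N P v" "en e = {u, v}"
    using on_cycle_spath[OF assms(3)] .
  obtain f I W where s: "inner e \<subseteq> closure (I \<inter> f)" "inner e \<subseteq> closure (W \<inter> f)"
      "{\<psi> \<in> faces crv H. borders e \<psi>} = {I \<inter> f, W \<inter> f}"
    by (rule two_bordering_faces[OF assms(1,2) p])
  have "\<psi> \<in> {\<psi> \<in> faces crv H. borders e \<psi>}" using assms(4,5) by simp
  then have "\<psi> = I \<inter> f \<or> \<psi> = W \<inter> f" unfolding s(3) by simp
  then have "inner e \<subseteq> closure \<psi>" using s(1,2) by (elim disjE) simp_all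
  then have cl: "closure (inner e) \<subseteq> closure \<psi>" by (rule closure_minimal) simp
  have "e \<in> X" using assms(1,2) by (rule subsetD)
  from img_subset_closure_inner[OF this] cl show ?thesis by (rule subset_trans)
qed

text \<open>Applied to one side \<open>W\<close> of a Jordan curve through \<open>e\<close>, with the drawing removed: some face bordered
  by \<open>e\<close> lies on that side.\<close>

lemma bordering_face_meets_side:
  assumes H: "H \<subseteq> X" "e \<in> H" "on_cycle en H e"
    and W: "W \<inter> drawing crv H = {}" "inner e \<inter> closure W \<noteq> {}"
  shows "\<exists>\<psi>\<in>faces crv H. borders e \<psi> \<and> \<psi> \<inter> W \<noteq> {}"
proof -
  obtain u v N P where p: "spath en (H - {e}) u N P v" "en e = {u, v}"
    using on_cycle_spath[OF H(3)] .
  obtain f I O' where f: "f \<in> faces crv (H - {e})" "inner e \<subseteq> f"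
    and IO: "I \<union> O' = - drawing crv (insert e P)"
      "{\<psi> \<in> faces crv H. borders e \<psi>} = {I \<inter> f, O' \<inter> f}"
    by (rule two_bordering_faces[OF H(1,2) p])
  have "H - {e} \<subseteq> X" using H(1) by blast
  then have "open f" using open_face f(1) by blast
  moreover have "f \<inter> closure W \<noteq> {}" using f(2) W(2) by blast
  ultimately have "f \<inter> W \<noteq> {}" using open_Int_closure_eq_empty by blast
  then obtain y where y: "y \<in> f" "y \<in> W" by blast
  have "insert e P \<subseteq> H" using spath_nodes(3)[OF p(1)] H(2) by blast
  then have "y \<notin> drawing crv (insert e P)" using W(1) y(2) drawing_mono by blast
  then have "y \<in> I \<inter> f \<or> y \<in> O' \<inter> f" using IO(1) y(1) by blast
  moreover have "I \<inter> f \<in> {\<psi> \<in> faces crv H. borders e \<psi>}" "O' \<inter> f \<in> {\<psi> \<in> faces crv H. borders e \<psi>}"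
    unfolding IO(2) by simp_all
  ultimately show ?thesis using y(2) by blast
qed

text \<open>For a bridge \<open>e\<close>, the rest of the drawing falls into two disjoint parts \<open>A\<close> and \<open>B\<close>, each of which
  meets \<open>e\<close> in at most one point. Gluing \<open>A\<close>, \<open>e\<close> and \<open>B\<close> together, Janiszewski's theorem applies
  twice and shows that \<open>e\<close> does not separate the face around it.\<close>

lemma bridge_borders_one_face:
  assumes H: "H \<subseteq> X" "e \<in> H" "\<not> on_cycle en H e"
    and \<psi>: "\<psi> \<in> faces crv H" "borders e \<psi>" and \<phi>: "\<phi> \<in> faces crv H" "borders e \<phi>"
  shows "\<psi> = \<phi>"
proof -
  have eX: "e \<in> X" using H by blast
  obtain u v where e: "en e = {u, v}" using card_en[OF eX] by (meson card_2_iff)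
  have nr: "\<not> reach en (H - {e}) u v" using H(3) e unfolding on_cycle_def by blast
  obtain f where f: "f \<in> faces crv (H - {e})" "inner e \<subseteq> f" using face_around_inner[OF H(1,2)] by blast
  obtain a b where ab: "a \<in> \<psi>" "b \<in> \<phi>" using face_nonempty[OF \<psi>(1)] face_nonempty[OF \<phi>(1)] by blast
  have "a \<in> f" "b \<in> f"
    using bordering_face_subset[OF H(1) \<psi> f] bordering_face_subset[OF H(1) \<phi> f] ab by auto
  then have ccR: "connected_component (- drawing crv (H - {e})) a b"
    using connected_component_of_components f(1) unfolding faces_def by blast
  define A where "A = {e' \<in> H - {e}. \<exists>y\<in>en e'. reach en (H - {e}) u y}"
  define B where "B = H - {e} - A"
  have sub: "A \<subseteq> X" "B \<subseteq> X" "A \<subseteq> H - {e}" "B \<subseteq> H - {e}" "e \<notin> A" "e \<notin> B"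
    using H(1) by (auto simp: A_def B_def)
  have ccA: "connected_component (- drawing crv A) a b"
    and ccB: "connected_component (- drawing crv B) a b"
    using connected_component_of_subset[OF ccR] drawing_mono[OF sub(3)] drawing_mono[OF sub(4)]
    by auto
  have A_reach: "reach en (H - {e}) u y" if e'A: "e' \<in> A" and y: "y \<in> en e'" for e' y
  proof -
    obtain z where z: "z \<in> en e'" "reach en (H - {e}) u z"
      using e'A unfolding A_def by (elim CollectE conjE bexE) (rule that)
    have e'X: "e' \<in> X" "e' \<in> H - {e}" using e'A sub(1,3) by auto
    obtain c d where cd: "en e' = {c, d}" using card_en[OF e'X(1)] by (meson card_2_iff)
    have "reach en (H - {e}) z y"
    proof (cases "z = y")
      case False
      then have "en e' = {z, y}" using z(1) y cd by auto
      then show ?thesis by (rule reach_edge[OF e'X(2)])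
    qed simp
    with z(2) show ?thesis by (rule reach_trans)
  qed
  have conn_le1: "connected T" if "T \<subseteq> {x}" for T :: "complex set" and x
  proof -
    have "T = {} \<or> T = {x}" using that by blast
    then show ?thesis by auto
  qed
  have e_meets: "img e \<inter> drawing crv K \<subseteq> pos ` en e" if "K \<subseteq> X" "e \<notin> K" for K
    using inner_disjoint_drawing[OF eX that] by (auto simp: inner_def)
  have Ae: "drawing crv A \<inter> img e \<subseteq> {pos u}"
  proof
    fix x assume x: "x \<in> drawing crv A \<inter> img e"
    then have "x \<in> pos ` en e" using e_meets[OF sub(1,5)] by blast
    moreover have "x \<noteq> pos v"
    proof
      assume "x = pos v"
      then obtain e' where e': "e' \<in> A" "pos v \<in> img e'" using x by (auto simp: drawing_def)
      then have "v \<in> en e'" using node_in_img[of e' e v] eX e sub(1) by auto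
      then show False using A_reach e'(1) nr by blast
    qed
    ultimately show "x \<in> {pos u}" using e by auto
  qed
  have Be: "drawing crv B \<inter> img e \<subseteq> {pos v}"
  proof
    fix x assume x: "x \<in> drawing crv B \<inter> img e"
    then have "x \<in> pos ` en e" using e_meets[OF sub(2,6)] by blast
    moreover have "x \<noteq> pos u"
    proof
      assume "x = pos u"
      then obtain e' where e': "e' \<in> B" "pos u \<in> img e'" using x by (auto simp: drawing_def)
      then have "u \<in> en e'" using node_in_img[of e' e u] eX e sub(2) by auto
      then show False using e'(1) by (auto simp: A_def B_def)
    qed
    ultimately show "x \<in> {pos v}" using e by auto
  qed
  have AB: "drawing crv A \<inter> drawing crv B = {}"
  proof -
    have "img e1 \<inter> img e2 = {}" if "e1 \<in> A" "e2 \<in> B" for e1 e2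
    proof -
      have "e1 \<noteq> e2" using that by (auto simp: B_def)
      moreover have "en e1 \<inter> en e2 = {}"
        using A_reach[OF that(1)] that(2) by (auto simp: A_def B_def)
      ultimately show ?thesis using crv_meet[of e1 e2] that sub(1,2) by auto
    qed
    then show ?thesis by (auto simp: drawing_def)
  qed
  have D: "drawing crv H = drawing crv A \<union> img e \<union> drawing crv B"
    using H(2) by (auto simp: drawing_def B_def A_def)
  have notin: "a \<notin> img e" "b \<notin> img e"
    using ab face_disjoint_drawing[OF \<psi>(1)] face_disjoint_drawing[OF \<phi>(1)] img_subset_drawing[OF H(2)]
    by blast+
  have cc1: "connected_component (- (drawing crv A \<union> img e)) a b"
  proof (rule Janiszewski)
    show "compact (drawing crv A)" by (rule compact_drawing[OF sub(1)])
    show "closed (img e)" using compact_img[OF eX] by (rule compact_imp_closed)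
    show "connected (drawing crv A \<inter> img e)" by (rule conn_le1[OF Ae])
    show "connected_component (- drawing crv A) a b" by (rule ccA)
    show "connected_component (- img e) a b"
      by (rule connected_componentI[OF connected_arc_complement[OF arc_crv[OF eX]]]) (use notin in auto)
  qed
  have "connected_component (- (drawing crv A \<union> img e \<union> drawing crv B)) a b"
  proof (rule Janiszewski)
    show "compact (drawing crv A \<union> img e)"
      using compact_drawing[OF sub(1)] compact_img[OF eX] by (rule compact_Un)
    show "closed (drawing crv B)" by (rule closed_drawing[OF sub(2)])
    show "connected ((drawing crv A \<union> img e) \<inter> drawing crv B)"
      by (rule conn_le1[of _ "pos v"]) (use AB Be in blast)
  qed (rule cc1 ccB)+
  then have "connected_component (- drawing crv H) a b" unfolding D .
  then show ?thesis using components_joined_eq \<psi>(1) \<phi>(1) ab unfolding faces_def by blast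
qed
end

section \<open>The boundary of a face is even\<close>

context plane_graph
begin

lemma finite_cut: "H \<subseteq> X \<Longrightarrow> finite (cut en H U)"
  using finite_subset[OF _ finite_X] by (auto simp: cut_def)

lemma cut_boundary: "cut en (boundary H \<psi>) U = {e \<in> cut en H U. on_cycle en H e \<and> borders e \<psi>}"
  by (auto simp: cut_def boundary_def)

lemma subset_side_if_meets:
  assumes W: "open W" "frontier W \<subseteq> D" "\<psi> \<inter> D = {}" "connected \<psi>" "\<psi> \<inter> W \<noteq> {}"
  shows "\<psi> \<subseteq> W"
proof (rule ccontr)
  assume "\<not> \<psi> \<subseteq> W"
  then have "\<psi> \<inter> frontier W \<noteq> {}" using connected_Int_frontier[OF W(4,5)] by blast
  then show False using W(2,3) by blast
qed

text \<open>Modulo 2, the boundaries of the faces inside a cycle add up to the cycle: an edge of the cycle has one of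
  its two faces on each side, any other edge that is no bridge has both faces on the same side.\<close>

lemma cycle_faces_parity:
  assumes H: "H \<subseteq> X" and P: "spath en (H - {e}) u N P v" "en e = {u, v}" "e \<in> H"
    and W: "open W" "frontier W = drawing crv (insert e P)"
    and W': "open W'" "frontier W' = drawing crv (insert e P)" "W \<inter> W' = {}"
      "W \<union> W' = - drawing crv (insert e P)"
    and e': "e' \<in> H" "on_cycle en H e'"
  shows "odd (card {\<psi> \<in> faces crv H. borders e' \<psi> \<and> \<psi> \<subseteq> W}) \<longleftrightarrow> e' \<in> insert e P"
proof -
  let ?Z = "insert e P" and ?B = "{\<psi> \<in> faces crv H. borders e' \<psi>}"
  have ZH: "?Z \<subseteq> H" using spath_nodes(3)[OF P(1)] P(3) by blast
  have e'X: "e' \<in> X" using e'(1) H by blast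
  note two = card_bordering_faces[OF H e']
  have inside: "\<psi> \<subseteq> V" if "\<psi> \<in> faces crv H" "\<psi> \<inter> V \<noteq> {}" "open V" "frontier V = drawing crv ?Z" for \<psi> V
    by (rule subset_side_if_meets[OF that(3) _ face_disjoint_drawing[OF that(1)] face_connected[OF that(1)] that(2)])
       (use that(4) drawing_mono[OF ZH] in simp)
  have eq: "{\<psi> \<in> faces crv H. borders e' \<psi> \<and> \<psi> \<subseteq> W} = {\<psi> \<in> ?B. \<psi> \<subseteq> W}" by auto
  show ?thesis
  proof (cases "e' \<in> ?Z")
    case True
    have sub: "inner e' \<subseteq> drawing crv ?Z" using True by (auto simp: drawing_def inner_def)
    have disj: "V \<inter> drawing crv ?Z = {}" if "V \<subseteq> W \<union> W'" for V using that W'(4) by blast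
    have ex: "\<exists>\<psi>\<in>?B. \<psi> \<subseteq> V" if V: "open V" "frontier V = drawing crv ?Z" "V \<subseteq> W \<union> W'" for V
    proof -
      define V' where "V' = V - drawing crv H"
      have "inner e' \<inter> closure V' \<noteq> {}"
      proof -
        obtain x where x: "x \<in> inner e'" using inner_nonempty[OF e'X] by blast
        have "H - {e'} \<subseteq> X" using H by blast
        then have op: "open (- drawing crv (H - {e'}))" and "x \<in> - drawing crv (H - {e'})"
          using closed_drawing inner_disjoint_drawing[OF e'X, of "H - {e'}"] x by auto
        moreover have "x \<in> closure V" using sub x V(2) by (auto simp: frontier_def)
        ultimately have "x \<in> closure (- drawing crv (H - {e'}) \<inter> V)"
          using open_Int_closure_subset[OF op, of V] by blast
        moreover have "drawing crv H = img e' \<union> drawing crv (H - {e'})"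
          using e'(1) by (auto simp: drawing_def)
        then have "- drawing crv (H - {e'}) \<inter> V \<subseteq> V'"
          using disj[OF V(3)] img_subset_drawing[OF True] unfolding V'_def by blast
        ultimately have "x \<in> closure V'" using closure_mono by blast
        then show ?thesis using x by blast
      qed
      then obtain \<psi> where "\<psi> \<in> faces crv H" "borders e' \<psi>" "\<psi> \<inter> V' \<noteq> {}"
        using bordering_face_meets_side[OF H e', of V'] by (auto simp: V'_def)
      then show ?thesis using inside[of \<psi> V] V(1,2) by (auto simp: V'_def)
    qed
    obtain \<psi> \<phi> where \<psi>: "\<psi> \<in> ?B" "\<psi> \<subseteq> W" and \<phi>: "\<phi> \<in> ?B" "\<phi> \<subseteq> W'"
      using ex[OF W] ex[OF W'(1,2)] by blast
    have nW: "\<not> \<phi> \<subseteq> W" using \<phi> W'(3) face_nonempty[of \<phi> H] by blast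
    have "\<psi> \<noteq> \<phi>" using \<psi>(2) nW by blast
    then have "card {\<psi>, \<phi>} = 2" by simp
    then have "{\<psi>, \<phi>} = ?B" using two \<psi>(1) \<phi>(1) by (intro card_seteq) auto
    then have "{\<psi> \<in> ?B. \<psi> \<subseteq> W} = {\<psi>}" using \<psi>(2) nW by blast
    then show ?thesis unfolding eq using True by simp
  next
    case False
    have "inner e' \<inter> drawing crv ?Z = {}"
      using inner_disjoint_drawing[OF e'X _ False] ZH H by blast
    then have "inner e' \<subseteq> W \<or> inner e' \<inter> W = {}"
      using subset_side_if_meets[of W "drawing crv ?Z" "inner e'"] W connected_inner[OF e'X] by blast
    then have "{\<psi> \<in> ?B. \<psi> \<subseteq> W} = ?B \<or> {\<psi> \<in> ?B. \<psi> \<subseteq> W} = {}"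
    proof
      assume "inner e' \<subseteq> W"
      then have "\<psi> \<subseteq> W" if "\<psi> \<in> ?B" for \<psi>
        using that inside[of \<psi> W] bordering_face_meets[of e' \<psi> W] W by blast
      then show ?thesis by blast
    next
      assume "inner e' \<inter> W = {}"
      then have "inner e' \<subseteq> W'" using W'(4) \<open>inner e' \<inter> drawing crv ?Z = {}\<close> by blast
      then have "\<psi> \<subseteq> W'" "\<psi> \<noteq> {}" if "\<psi> \<in> ?B" for \<psi>
        using that inside[of \<psi> W'] bordering_face_meets[of e' \<psi> W'] W' face_nonempty[of \<psi> H] by blast+
      then show ?thesis using W'(3) by blast
    qed
    moreover have "even (card ?B)" using two by simp
    ultimately have "even (card {\<psi> \<in> ?B. \<psi> \<subseteq> W})" by (elim disjE) (simp_all only: card.empty even_zero)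
    then show ?thesis unfolding eq using False by simp
  qed
qed

text \<open>The faces away from \<open>e\<close> keep their boundary when \<open>e\<close> is deleted. The only danger is an edge that
  becomes a bridge; it would then border a single face, whereas before the deletion it bordered
  two faces, both of them contained in that one.\<close>

lemma boundary_delete_edge:
  assumes H: "H \<subseteq> X" "e \<in> H" "on_cycle en H e"
    and \<psi>: "\<psi> \<in> faces crv H" "\<not> borders e \<psi>"
  shows "\<psi> \<in> faces crv (H - {e})" "boundary H \<psi> = boundary (H - {e}) \<psi>"
proof -
  obtain u v N P where p: "spath en (H - {e}) u N P v" "en e = {u, v}"
    using on_cycle_spath[OF H(3)] .
  obtain f I W where f: "faces crv H = faces crv (H - {e}) - {f} \<union> {I \<inter> f, W \<inter> f}"
      "{\<psi> \<in> faces crv H. borders e \<psi>} = {I \<inter> f, W \<inter> f}"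
    by (rule two_bordering_faces[OF H(1,2) p])
  have "\<psi> \<notin> {I \<inter> f, W \<inter> f}" using \<psi>(2) f(2)[symmetric] by simp
  then show face: "\<psi> \<in> faces crv (H - {e})" using \<psi>(1) f(1) by simp
  have HX: "H - {e} \<subseteq> X" using H(1) by blast
  have "on_cycle en (H - {e}) e'" if e': "e' \<in> H" "e' \<noteq> e" "on_cycle en H e'" "borders e' \<psi>" for e'
  proof (rule ccontr)
    assume bridge: "\<not> on_cycle en (H - {e}) e'"
    have "{\<phi> \<in> faces crv H. borders e' \<phi>} \<noteq> {\<psi>}"
      using card_bordering_faces(2)[OF H(1) e'(1,3)] by auto
    then obtain \<phi> where \<phi>: "\<phi> \<in> faces crv H" "borders e' \<phi>" "\<phi> \<noteq> \<psi>" using \<psi>(1) e'(4) by blast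
    obtain \<phi>' where \<phi>': "\<phi>' \<in> faces crv (H - {e})" "\<phi> \<subseteq> \<phi>'"
      using face_coarser[of "H - {e}" H \<phi>] \<phi>(1) by blast
    have "\<phi>' = \<psi>"
      by (rule bridge_borders_one_face[OF HX _ bridge \<phi>'(1) borders_mono[OF \<phi>'(2) \<phi>(2)] face e'(4)])
         (use e'(1,2) in simp)
    then have "\<phi> \<inter> \<psi> \<noteq> {}" using \<phi>'(2) face_nonempty[OF \<phi>(1)] by blast
    then show False using faces_eq_if_meet[OF \<phi>(1) \<psi>(1)] \<phi>(3) by blast
  qed
  moreover have "on_cycle en H e'" if "on_cycle en (H - {e}) e'" for e'
    using on_cycle_mono[OF _ that] by blast
  ultimately show "boundary H \<psi> = boundary (H - {e}) \<psi>"
    using \<psi>(2) unfolding boundary_def by blast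
qed

text \<open>The boundary of a face is a sum of cycles, so that it meets every cut in an even number of edges. For an
  edge \<open>e\<close> on the boundary of \<open>\<psi>\<close>, choose a cycle through \<open>e\<close> and add up the boundaries of all faces on the
  same side as \<open>\<psi>\<close>. The sum is the cycle, which meets the cut evenly. The other summands are
  not bordered by \<open>e\<close>, so they are boundaries of faces of the graph without \<open>e\<close>, and the induction
  hypothesis applies to them.\<close>

lemma boundary_cut_even:
  assumes "H \<subseteq> X" "\<psi> \<in> faces crv H"
  shows "even (card (cut en (boundary H \<psi>) U))"
  using assms
proof (induction "card H" arbitrary: H \<psi> rule: less_induct)
  case less
  note H = less.prems(1)
  have finH: "finite H" using finite_subset[OF H finite_X] .
  show ?case
  proof (cases "boundary H \<psi> = {}")
    case True
    then show ?thesis by (simp add: cut_def)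
  next
    case False
    then obtain e where e: "e \<in> H" "on_cycle en H e" "borders e \<psi>" by (auto simp: boundary_def)
    have eX: "e \<in> X" using e(1) H by blast
    obtain u v N P where p: "spath en (H - {e}) u N P v" "en e = {u, v}"
      using on_cycle_spath[OF e(2)] .
    let ?Z = "insert e P"
    have ZH: "?Z \<subseteq> H" using spath_nodes(3)[OF p(1)] e(1) by blast
    have IH: "even (card (cut en (boundary H \<phi>) U))" if "\<phi> \<in> faces crv H" "\<not> borders e \<phi>" for \<phi>
    proof -
      have "card (H - {e}) < card H" using finH e(1) by (rule card_Diff1_less)
      moreover have "H - {e} \<subseteq> X" using H by blast
      ultimately show ?thesis
        using less.hyps boundary_delete_edge[OF H e(1,2) that] by simp
    qed
    obtain W W' where W: "open W" "frontier W = drawing crv ?Z"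
      and W': "open W'" "frontier W' = drawing crv ?Z" "W \<inter> W' = {}" "W \<union> W' = - drawing crv ?Z"
      and \<psi>W: "\<psi> \<subseteq> W" and only: "\<And>\<phi>. \<phi> \<in> faces crv H \<Longrightarrow> borders e \<phi> \<Longrightarrow> \<phi> \<subseteq> W \<Longrightarrow> \<phi> = \<psi>"
    proof -
      obtain f I O' where s: "I \<inter> f \<noteq> O' \<inter> f"
        "open I" "open O'" "I \<inter> O' = {}" "I \<union> O' = - drawing crv ?Z"
        "frontier I = drawing crv ?Z" "frontier O' = drawing crv ?Z"
        "{\<psi> \<in> faces crv H. borders e \<psi>} = {I \<inter> f, O' \<inter> f}"
        by (rule two_bordering_faces[OF H e(1) p])
      have mem: "I \<inter> f \<in> faces crv H" "O' \<inter> f \<in> faces crv H" using s(8) by auto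
      have cases: "\<phi> = I \<inter> f \<or> \<phi> = O' \<inter> f" if "\<phi> \<in> faces crv H" "borders e \<phi>" for \<phi>
      proof -
        have "\<phi> \<in> {\<psi> \<in> faces crv H. borders e \<psi>}" using that by simp
        then show ?thesis unfolding s(8) by simp
      qed
      have nI: "\<not> O' \<inter> f \<subseteq> I" and nO: "\<not> I \<inter> f \<subseteq> O'"
        using s(4) face_nonempty[OF mem(1)] face_nonempty[OF mem(2)] by blast+
      from cases[OF less.prems(2) e(3)] show thesis
      proof
        assume eq: "\<psi> = I \<inter> f"
        have "\<phi> = \<psi>" if "\<phi> \<in> faces crv H" "borders e \<phi>" "\<phi> \<subseteq> I" for \<phi>
          using cases[OF that(1,2)] that(3) nI eq by metis
        then show thesis using s eq by (intro that[of I O']) simp_all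
      next
        assume eq: "\<psi> = O' \<inter> f"
        have "\<phi> = \<psi>" if "\<phi> \<in> faces crv H" "borders e \<phi>" "\<phi> \<subseteq> O'" for \<phi>
          using cases[OF that(1,2)] that(3) nO eq by metis
        moreover have "O' \<inter> I = {}" "O' \<union> I = - drawing crv ?Z" using s(4,5) by auto
        ultimately show thesis using s(2,3,6,7) eq by (intro that[of O' I]) simp_all
      qed
    qed
    define E where "E = {e' \<in> cut en H U. on_cycle en H e'}"
    define \<Phi> where "\<Phi> = {\<phi> \<in> faces crv H. \<phi> \<subseteq> W \<and> (\<exists>e'\<in>H. on_cycle en H e' \<and> borders e' \<phi>)}"
    have finE: "finite E" using finite_cut[OF H] by (simp add: E_def)
    have "\<Phi> \<subseteq> (\<Union>e'\<in>{e' \<in> H. on_cycle en H e'}. {\<phi> \<in> faces crv H. borders e' \<phi>})"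
      by (auto simp: \<Phi>_def)
    then have fin\<Phi>: "finite \<Phi>"
      by (rule finite_subset) (use finH card_bordering_faces(1)[OF H] in auto)
    have "(\<Sum>\<phi>\<in>\<Phi>. card (cut en (boundary H \<phi>) U)) = (\<Sum>\<phi>\<in>\<Phi>. card {e' \<in> E. borders e' \<phi>})"
      by (simp add: cut_boundary E_def conj_assoc)
    also have "\<dots> = (\<Sum>e'\<in>E. card {\<phi> \<in> \<Phi>. borders e' \<phi>})"
      by (rule sum_multicount_gen[OF fin\<Phi> finE]) simp
    finally have swap: "(\<Sum>\<phi>\<in>\<Phi>. card (cut en (boundary H \<phi>) U)) = (\<Sum>e'\<in>E. card {\<phi> \<in> \<Phi>. borders e' \<phi>})" .
    have "even (\<Sum>e'\<in>E. card {\<phi> \<in> \<Phi>. borders e' \<phi>})"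
    proof -
      have par: "odd (card {\<phi> \<in> \<Phi>. borders e' \<phi>}) \<longleftrightarrow> e' \<in> ?Z" if "e' \<in> E" for e'
      proof -
        have e': "e' \<in> H" "on_cycle en H e'" using that by (auto simp: E_def cut_def)
        then have "{\<phi> \<in> \<Phi>. borders e' \<phi>} = {\<phi> \<in> faces crv H. borders e' \<phi> \<and> \<phi> \<subseteq> W}"
          by (auto simp: \<Phi>_def)
        then show ?thesis using cycle_faces_parity[OF H p e(1) W W' e'] by simp
      qed
      have "{e' \<in> E. odd (card {\<phi> \<in> \<Phi>. borders e' \<phi>})} = {e' \<in> E. e' \<in> ?Z}"
        using par by blast
      also have "\<dots> = cut en ?Z U"
        using cycle_edges_on_cycle[OF p(1) p(2) e(1)] ZH by (auto simp: E_def cut_def)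
      finally have "even (card {e' \<in> E. odd (card {\<phi> \<in> \<Phi>. borders e' \<phi>})})"
        using cycle_cut_even[OF p] by simp
      then show ?thesis using even_sum_iff[OF finE] by blast
    qed
    moreover have "\<psi> \<in> \<Phi>" using less.prems(2) \<psi>W e unfolding \<Phi>_def by blast
    moreover have "even (\<Sum>\<phi>\<in>\<Phi> - {\<psi>}. card (cut en (boundary H \<phi>) U))"
    proof (rule dvd_sum)
      fix \<phi> assume \<phi>: "\<phi> \<in> \<Phi> - {\<psi>}"
      then have "\<phi> \<in> faces crv H" "\<phi> \<subseteq> W" "\<phi> \<noteq> \<psi>" by (simp_all add: \<Phi>_def)
      then show "even (card (cut en (boundary H \<phi>) U))" using IH only by metis
    qed
    ultimately show ?thesis
      using sum.remove[OF fin\<Phi>, of \<psi> "\<lambda>\<phi>. card (cut en (boundary H \<phi>) U)"] swap by simp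
  qed
qed
end

section \<open>Bonds, tours of face boundaries, and the links of one face\<close>

context plane_graph
begin

lemma connected_drawing:
  assumes "\<And>u v. u \<in> \<Union>(en ` X) \<Longrightarrow> v \<in> \<Union>(en ` X) \<Longrightarrow> reach en X u v"
  shows "connected (drawing crv X)"
proof -
  have conn_img: "connected_component (drawing crv X) x y" if "e \<in> X" "x \<in> img e" "y \<in> img e" for e x y
    by (rule connected_componentI[OF connected_path_image[OF arc_imp_path[OF arc_crv[OF that(1)]]]])
       (use that in \<open>auto simp: drawing_def\<close>)
  have node: "connected_component (drawing crv X) (pos u) (pos v)"
    if "reach en X u v" "pos u \<in> drawing crv X" for u v
    using that(1)
  proof (induction rule: reach_induct)
    case refl
    then show ?case using that(2) by simp
  next
    case (step x y e)
    have "pos x \<in> img e" "pos y \<in> img e" using ends_in_img[OF step.hyps(2)] step.hyps(3) by auto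
    then show ?case using conn_img[OF step.hyps(2)] step.IH connected_component_trans by metis
  qed
  have "connected_component (drawing crv X) x y"
    if xy: "x \<in> drawing crv X" "y \<in> drawing crv X" for x y
  proof -
    obtain e e' where e: "e \<in> X" "x \<in> img e" "e' \<in> X" "y \<in> img e'"
      using xy unfolding drawing_def by auto
    obtain u v where uv: "u \<in> en e" "v \<in> en e'" using card_en[OF e(1)] card_en[OF e(3)] by fastforce
    have im: "pos u \<in> img e" "pos v \<in> img e'" using ends_in_img e uv by blast+
    have "reach en X u v" using assms[of u v] e uv by auto
    then have "connected_component (drawing crv X) (pos u) (pos v)"
      by (rule node) (use im(1) e(1) in \<open>auto simp: drawing_def\<close>)
    then show ?thesis
      using conn_img[OF e(1,2) im(1)] conn_img[OF e(3) im(2) e(4)] connected_component_trans by metis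
  qed
  then show ?thesis unfolding connected_iff_connected_component by blast
qed

context
  assumes bridgeless: "\<And>e. e \<in> X \<Longrightarrow> on_cycle en X e"
    and reach_X: "\<And>u v. u \<in> \<Union>(en ` X) \<Longrightarrow> v \<in> \<Union>(en ` X) \<Longrightarrow> reach en X u v"
begin

lemma boundary_eq: "boundary X \<psi> = {e \<in> X. borders e \<psi>}"
  using bridgeless by (auto simp: boundary_def)

lemma frontier_face_subset: "\<psi> \<in> faces crv X \<Longrightarrow> frontier \<psi> \<subseteq> drawing crv X"
  unfolding faces_def using frontier_of_components_closed_complement closed_drawing by blast

text \<open>A point of the frontier in the inside of an edge puts that edge on the boundary. It remains to exclude
  that the frontier touches an edge in a node only. A small disc around that node, without the
  nodes in it, is connected and contains points of the face as well as points of an edge; hence it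
  meets the frontier, necessarily in the inside of an edge at that node.\<close>

lemma frontier_face:
  assumes \<psi>: "\<psi> \<in> faces crv X"
  shows "frontier \<psi> = drawing crv (boundary X \<psi>)"
proof
  have op: "open \<psi>" by (rule open_face[OF _ \<psi>]) simp
  have fr: "frontier \<psi> = closure \<psi> - \<psi>" using op by (simp add: frontier_def interior_open)
  show "drawing crv (boundary X \<psi>) \<subseteq> frontier \<psi>"
  proof
    fix x assume "x \<in> drawing crv (boundary X \<psi>)"
    then obtain e where e: "e \<in> X" "borders e \<psi>" "x \<in> img e" by (auto simp: drawing_def boundary_eq)
    have "x \<in> closure \<psi>" using borders_closure[OF _ e(1) bridgeless[OF e(1)] \<psi> e(2)] e(3) by blast
    moreover have "x \<notin> \<psi>" using face_disjoint_drawing[OF \<psi>] img_subset_drawing[OF e(1)] e(3) by blast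
    ultimately show "x \<in> frontier \<psi>" by (simp add: fr)
  qed
  show "frontier \<psi> \<subseteq> drawing crv (boundary X \<psi>)"
  proof
    fix x assume x: "x \<in> frontier \<psi>"
    then obtain e where e: "e \<in> X" "x \<in> img e"
      using frontier_face_subset[OF \<psi>] by (auto simp: drawing_def)
    show "x \<in> drawing crv (boundary X \<psi>)"
    proof (rule ccontr)
      assume no: "x \<notin> drawing crv (boundary X \<psi>)"
      define K where "K = {e \<in> X. x \<notin> img e}"
      define N where "N = pos ` \<Union>(en ` X)"
      have "finite (en e)" if "e \<in> X" for e using card_en[OF that] by (intro card_ge_0_finite) simp
      then have finN: "finite N" unfolding N_def using finite_X by simp
      have "x \<in> - drawing crv K" by (auto simp: K_def drawing_def)
      moreover have "open (- drawing crv K)" using closed_drawing[of K] by (auto simp: K_def)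
      ultimately obtain r where r: "0 < r" "ball x r \<subseteq> - drawing crv K"
        using openE by metis
      (* The disc meets only edges through x, and without the nodes it meets them in inner points. *)
      have conn: "connected (ball x r - N)"
        by (rule connected_open_delete_finite) (auto simp: finN)
      have xc: "x \<in> closure \<psi>" using x by (simp add: fr)
      have "x \<in> closure (inner e)" using img_subset_closure_inner[OF e(1)] e(2) by blast
      then obtain y where y: "y \<in> inner e" "y \<in> ball x r"
        using r(1) closure_approachable[of x "inner e"] by (auto simp: dist_commute)
      have yN: "y \<notin> N"
      proof
        assume "y \<in> N"
        then obtain e' v where v: "e' \<in> X" "v \<in> en e'" "y = pos v" by (auto simp: N_def)
        then have "v \<in> en e" using node_in_img[OF e(1) v(1,2)] y(1) by (auto simp: inner_def)
        then show False using y(1) v(3) by (auto simp: inner_def)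
      qed
      obtain z where z: "z \<in> \<psi>" "z \<in> ball x r"
        using xc r(1) closure_approachable[of x \<psi>] by (auto simp: dist_commute)
      have "N \<subseteq> drawing crv X" using ends_in_img by (fastforce simp: N_def drawing_def)
      then have zN: "z \<notin> N" using z(1) face_disjoint_drawing[OF \<psi>] by blast
      have "y \<notin> \<psi>"
        using y(1) face_disjoint_drawing[OF \<psi>] img_subset_drawing[OF e(1)] by (auto simp: inner_def)
      then have "(ball x r - N) \<inter> frontier \<psi> \<noteq> {}"
        using connected_Int_frontier[OF conn, of \<psi>] y(2) yN z zN by blast
      then obtain y' where y': "y' \<in> ball x r" "y' \<notin> N" "y' \<in> frontier \<psi>" by blast
      then obtain e' where e': "e' \<in> X" "y' \<in> img e'"
        using frontier_face_subset[OF \<psi>] by (auto simp: drawing_def)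
      have "y' \<in> inner e'" using e' y'(2) by (auto simp: inner_def N_def)
      moreover have "y' \<in> closure \<psi>" using y'(3) by (simp add: fr)
      ultimately have "e' \<in> boundary X \<psi>" using e'(1) by (auto simp: boundary_eq borders_def)
      moreover have "e' \<notin> K" using r(2) y'(1) e'(2) by (auto simp: drawing_def)
      ultimately show False using no e'(1) by (auto simp: K_def drawing_def)
    qed
  qed
qed

lemma frontier_node_on_boundary:
  assumes \<psi>: "\<psi> \<in> faces crv X" and v: "v \<in> \<Union>(en ` X)" "pos v \<in> frontier \<psi>"
  shows "v \<in> \<Union>(en ` boundary X \<psi>)"
proof -
  obtain e' where e': "e' \<in> X" "v \<in> en e'" using v(1) by blast
  obtain e where e: "e \<in> boundary X \<psi>" "pos v \<in> img e"
    using v(2) unfolding frontier_face[OF \<psi>] by (auto simp: drawing_def)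
  have "e \<in> X" using e(1) by (simp add: boundary_eq)
  from node_in_img[OF this e' e(2)] show ?thesis using e(1) by blast
qed

text \<open>The frontier of a complementary component of a connected set is connected in the plane, so that it is
  not the disjoint union of two closed drawings.\<close>

lemma boundary_connected:
  assumes \<psi>: "\<psi> \<in> faces crv X"
    and T: "T \<subseteq> boundary X \<psi>" "T \<noteq> {}" "T \<noteq> boundary X \<psi>"
  shows "\<exists>e\<in>boundary X \<psi> - T. \<exists>e'\<in>T. en e \<inter> en e' \<noteq> {}"
proof (rule ccontr)
  assume none: "\<not> ?thesis"
  let ?A = "drawing crv T" and ?B = "drawing crv (boundary X \<psi> - T)"
  have X: "boundary X \<psi> \<subseteq> X" by (auto simp: boundary_eq)
  have "connected (frontier \<psi>)"
    using connected_frontier_component_complement[OF connected_drawing[OF reach_X]] \<psi>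
    by (simp add: faces_def)
  moreover have "frontier \<psi> = ?A \<union> ?B" using T(1) by (auto simp: frontier_face[OF \<psi>] drawing_def)
  moreover have "closed ?A" by (rule closed_drawing) (use T(1) X in blast)
  moreover have "closed ?B" by (rule closed_drawing) (use X in blast)
  moreover have "?A \<inter> ?B = {}"
  proof -
    have "img e' \<inter> img e = {}" if e: "e \<in> boundary X \<psi> - T" "e' \<in> T" for e e'
    proof -
      have "en e' \<inter> en e = {}" using none e by blast
      moreover have "e \<in> X" "e' \<in> X" "e' \<noteq> e" using e T(1) X by auto
      ultimately show ?thesis using crv_meet[of e' e] by simp
    qed
    then show ?thesis by (force simp: drawing_def)
  qed
  ultimately have "?A = {} \<or> ?B = {}"
    using connected_closedD[of "frontier \<psi>" ?A ?B] by (metis Int_Un_distrib2 Int_absorb Int_commute Un_upper1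
        inf.absorb_iff2 order_refl sup_bot_left)
  have nonempty: "drawing crv K \<noteq> {}" if "K \<noteq> {}" for K
    using that by (auto simp: drawing_def)
  have "boundary X \<psi> - T \<noteq> {}" using T(1,3) by blast
  from nonempty[OF T(2)] nonempty[OF this] show False using \<open>?A = {} \<or> ?B = {}\<close> by blast
qed

lemma boundary_tour:
  assumes \<psi>: "\<psi> \<in> faces crv X" and ne: "boundary X \<psi> \<noteq> {}"
  shows "\<exists>n p q. trail en (boundary X \<psi>) n p q \<and> q ` {..<n} = boundary X \<psi> \<and> p n = p 0"
proof (rule euler_tour[OF _ _ ne])
  show "finite (boundary X \<psi>)" using finite_X by (simp add: boundary_eq)
  show two: "card (en e) = 2" if "e \<in> boundary X \<psi>" for e using that card_en by (simp add: boundary_eq)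
  show "even (card {e \<in> boundary X \<psi>. v \<in> en e})" for v
  proof -
    have "en e - {v} \<noteq> {}" if "e \<in> boundary X \<psi>" for e
    proof
      assume "en e - {v} = {}"
      then have "card (en e) \<le> card {v}" by (intro card_mono) auto
      then show False using two[OF that] by simp
    qed
    then have "{e \<in> boundary X \<psi>. v \<in> en e} = cut en (boundary X \<psi>) {v}" by (auto simp: cut_def)
    then show ?thesis using boundary_cut_even[OF _ \<psi>] by simp
  qed
qed (rule boundary_connected[OF \<psi>])

text \<open>If a bond had three edges on the boundary of a face, keep these three and delete the rest of the bond. The
  face becomes part of a larger face, and the three edges are still on its boundary, each being on a
  cycle together with another of the three. But now they form a whole cut, which the boundary has to
  meet in an even number of edges.\<close>

lemma bond_crosses_boundary_twice:
  assumes \<psi>: "\<psi> \<in> faces crv X" and F: "bond en X U F"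
  shows "card (F \<inter> boundary X \<psi>) \<in> {0, 2}"
proof -
  have Fcut: "F = cut en X U" using F by (simp only: bond_def)
  have FX: "F \<subseteq> X" by (auto simp: Fcut cut_def)
  have "cut en (boundary X \<psi>) U = F \<inter> boundary X \<psi>" by (auto simp: Fcut cut_def boundary_eq)
  then have even: "even (card (F \<inter> boundary X \<psi>))" using boundary_cut_even[OF _ \<psi>, of U] by simp
  have "card (F \<inter> boundary X \<psi>) < 3"
  proof (rule ccontr)
    assume "\<not> card (F \<inter> boundary X \<psi>) < 3"
    then have "3 \<le> card (F \<inter> boundary X \<psi>)" by simp
    then obtain T where T: "T \<subseteq> F \<inter> boundary X \<psi>" "card T = 3"
      by (rule obtain_subset_with_card_n)
    (* In this subgraph T is the whole cut between U and its complement. *)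
    define Y where "Y = (X - F) \<union> T"
    have YX: "Y \<subseteq> X" using T(1) FX by (auto simp: Y_def)
    obtain \<psi>' where \<psi>': "\<psi>' \<in> faces crv Y" "\<psi> \<subseteq> \<psi>'" using face_coarser[OF YX \<psi>] by blast
    have cyc: "on_cycle en Y e" if e: "e \<in> T" for e
    proof -
      have "T \<noteq> {e}" using T(2) by auto
      then obtain e2 where e2: "e2 \<in> T" "e2 \<noteq> e" using e by blast
      have eF: "e \<in> F" "e2 \<in> F" using e e2(1) T(1) by auto
      then have eX: "e \<in> X" "e2 \<in> X" using FX by auto
      show ?thesis
        by (rule bond_edge_on_cycle[OF F eF e2(2) card_en[OF eX(1)] card_en[OF eX(2)]])
           (simp_all add: Y_def e2(1))
    qed
    have Tb: "e \<in> boundary Y \<psi>'" if e: "e \<in> T" for e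
    proof -
      have "borders e \<psi>" using e T(1) by (auto simp: boundary_eq)
      then have "borders e \<psi>'" by (rule borders_mono[OF \<psi>'(2)])
      then show ?thesis using cyc[OF e] e by (simp add: boundary_def Y_def)
    qed
    have "cut en (boundary Y \<psi>') U = T"
    proof
      show "T \<subseteq> cut en (boundary Y \<psi>') U"
      proof
        fix e assume e: "e \<in> T"
        have "e \<in> cut en X U" using e T(1) Fcut by blast
        then show "e \<in> cut en (boundary Y \<psi>') U" using Tb[OF e] by (simp add: cut_def)
      qed
      show "cut en (boundary Y \<psi>') U \<subseteq> T"
      proof
        fix e assume "e \<in> cut en (boundary Y \<psi>') U"
        then have "e \<in> Y" "e \<in> cut en X U" using YX by (auto simp: cut_def boundary_def)
        then show "e \<in> T" unfolding Fcut[symmetric] Y_def by blast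
      qed
    qed
    then have "even (card T)" using boundary_cut_even[OF YX \<psi>'(1), of U] by simp
    then show False using T(2) by simp
  qed
  then have "card (F \<inter> boundary X \<psi>) = 0 \<or> card (F \<inter> boundary X \<psi>) = 1 \<or> card (F \<inter> boundary X \<psi>) = 2"
    by linarith
  then show ?thesis using even by auto
qed

text \<open>Number the nodes of a face by their position on an Euler tour of its boundary; for a node that the tour
  visits several times any of its positions will do. A bond crosses the tour twice, so one
  of its sides occupies an interval of positions. Whether this is the side \<open>U\<close> or the other one varies
  with the bond, so the statement only compares two nodes.\<close>

lemma bonds_are_intervals_on_face:
  assumes \<psi>: "\<psi> \<in> faces crv X" and ne: "boundary X \<psi> \<noteq> {}"
  shows "\<exists>\<kappa> :: 'v \<Rightarrow> int. \<forall>U F. bond en X U F \<longrightarrow>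
    F \<inter> boundary X \<psi> \<noteq> {} \<longrightarrow>
    (\<exists>a b. \<forall>u\<in>\<Union>(en ` boundary X \<psi>). \<forall>v\<in>\<Union>(en ` boundary X \<psi>).
        (u \<in> U \<longleftrightarrow> v \<in> U) \<longleftrightarrow> (\<kappa> u \<in> {a..b} \<longleftrightarrow> \<kappa> v \<in> {a..b}))"
proof -
  let ?C = "boundary X \<psi>"
  obtain n p q where t: "trail en ?C n p q" "q ` {..<n} = ?C" "p n = p 0"
    using boundary_tour[OF \<psi> ne] by blast
  have ex: "\<exists>k. k \<le> n \<and> p k = v" if v: "v \<in> \<Union>(en ` ?C)" for v
  proof -
    obtain e where e: "e \<in> ?C" "v \<in> en e" using v by blast
    obtain k where k: "k < n" "e = q k" using e(1) t(2) by blast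
    have "v = p k \<or> v = p (Suc k)" using t(1) k e(2) by (auto simp: trail_def)
    then show ?thesis using k(1) by (metis Suc_leI less_imp_le_nat)
  qed
  (* Integers, so that positions can be reflected when links enter an interval from the right. *)
  define \<kappa> where "\<kappa> v = int (SOME k. k \<le> n \<and> p k = v)" for v
  have \<kappa>: "\<exists>k. k \<le> n \<and> p k = v \<and> \<kappa> v = int k" if "v \<in> \<Union>(en ` ?C)" for v
    using someI_ex[OF ex[OF that]] by (auto simp: \<kappa>_def)
  have intervals: "\<exists>a b. \<forall>u\<in>\<Union>(en ` ?C). \<forall>v\<in>\<Union>(en ` ?C).
        (u \<in> U \<longleftrightarrow> v \<in> U) \<longleftrightarrow> (\<kappa> u \<in> {a..b} \<longleftrightarrow> \<kappa> v \<in> {a..b})"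
    if F: "bond en X U F" "F \<inter> ?C \<noteq> {}" for U F
  proof -
    have cutC: "cut en ?C U = F \<inter> ?C" using F(1) by (auto simp: bond_def cut_def boundary_eq)
    have "finite (F \<inter> ?C)" using finite_X by (simp add: boundary_eq)
    then have "card (F \<inter> ?C) = 2" using bond_crosses_boundary_twice[OF \<psi> F(1)] F(2) by auto
    moreover have "q ` {k \<in> {..<n}. q k \<in> F} = F \<inter> ?C" using t(2) by auto
    moreover have inj: "inj_on q {k \<in> {..<n}. q k \<in> F}"
      by (rule inj_on_subset[of q "{..<n}"]) (use t(1) in \<open>auto simp: trail_def\<close>)
    ultimately have "card {k \<in> {..<n}. q k \<in> F} = 2" using card_image[OF inj] by simp
    then obtain i j where ij: "{k \<in> {..<n}. q k \<in> F} = {i, j}" "i \<noteq> j" by (meson card_2_iff)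
    obtain k1 k2 where k12: "{k \<in> {..<n}. q k \<in> F} = {k1, k2}" "k1 < k2"
    proof (cases "i < j")
      case True
      then show ?thesis by (rule that[OF ij(1)])
    next
      case False
      show ?thesis by (rule that[of j i]) (use False ij in \<open>simp_all add: insert_commute\<close>)
    qed
    have "k2 < n" using k12(1) by blast
    have crossed: "q k \<in> cut en ?C U \<longleftrightarrow> k = k1 \<or> k = k2" if "k < n" for k
      using that k12(1) t(2) unfolding cutC by blast
    have side: "(v \<in> U \<longleftrightarrow> p 0 \<in> U) \<longleftrightarrow> \<kappa> v \<notin> {int (Suc k1)..int k2}" if v: "v \<in> \<Union>(en ` ?C)" for v
    proof -
      obtain k where k: "k \<le> n" "p k = v" "\<kappa> v = int k"
        using \<kappa>[OF v] by (elim exE conjE) (rule that)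
      have "\<kappa> v \<in> {int (Suc k1)..int k2} \<longleftrightarrow> k \<in> {Suc k1..k2}"
        by (simp only: k(3) atLeastAtMost_iff of_nat_le_iff)
      with closed_trail_crossed_twice[OF t(1) k12(2) \<open>k2 < n\<close> crossed k(1)] k(2) show ?thesis
        by simp
    qed
    have "(u \<in> U \<longleftrightarrow> v \<in> U) \<longleftrightarrow>
        (\<kappa> u \<in> {int (Suc k1)..int k2} \<longleftrightarrow> \<kappa> v \<in> {int (Suc k1)..int k2})"
      if "u \<in> \<Union>(en ` ?C)" "v \<in> \<Union>(en ` ?C)" for u v
      using side[OF that(1)] side[OF that(2)] by argo
    then show ?thesis by (intro exI ballI)
  qed
  show ?thesis by (rule exI[of _ \<kappa>], intro allI impI) (rule intervals)
qed

text \<open>The tour leads from one end of the pair to the other and has to change sides.\<close>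

lemma split_pair_crosses_boundary:
  assumes \<psi>: "\<psi> \<in> faces crv X" and F: "bond en X U F"
    and uv: "u \<in> \<Union>(en ` boundary X \<psi>)" "v \<in> \<Union>(en ` boundary X \<psi>)" "u \<in> U" "v \<notin> U"
  shows "card (F \<inter> boundary X \<psi>) = 2"
proof -
  let ?C = "boundary X \<psi>"
  have ne: "?C \<noteq> {}" using uv(1) by blast
  obtain n p q where t: "trail en ?C n p q" "q ` {..<n} = ?C" "p n = p 0"
    using boundary_tour[OF \<psi> ne] by blast
  have cutC: "cut en ?C U = F \<inter> ?C" using F by (auto simp: bond_def cut_def boundary_eq)
  have "F \<inter> ?C \<noteq> {}"
  proof
    assume "F \<inter> ?C = {}"
    then have none: "\<And>k. k < n \<Longrightarrow> q k \<notin> cut en ?C U" by (simp add: cutC)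
    have same: "x \<in> U \<longleftrightarrow> p 0 \<in> U" if x: "x \<in> \<Union>(en ` ?C)" for x
    proof -
      obtain e where e: "e \<in> ?C" "x \<in> en e" using x by blast
      obtain k where k: "k < n" "e = q k" using e(1) t(2) by blast
      have "x = p k \<or> x = p (Suc k)" using t(1) k e(2) by (auto simp: trail_def)
      then show ?thesis using trail_uncrossed[OF t(1) none] k(1) by (metis Suc_leI less_imp_le_nat)
    qed
    show False using same[OF uv(1)] same[OF uv(2)] uv(3,4) by simp
  qed
  moreover have "finite (F \<inter> ?C)" using finite_X by (simp add: boundary_eq)
  ultimately show ?thesis using bond_crosses_boundary_twice[OF \<psi> F] by auto
qed

text \<open>Double counting: each edge of \<open>F\<close> borders two faces, and each crossed face uses two edges of \<open>F\<close>.\<close>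

lemma card_crossed_faces:
  assumes "finite \<Psi>" "\<Psi> \<subseteq> faces crv X" "F \<subseteq> X"
    and "\<forall>\<psi>\<in>\<Psi>. card (F \<inter> boundary X \<psi>) = 2"
  shows "card \<Psi> \<le> card F"
proof -
  have finF: "finite F" using assms(3) finite_X by (rule finite_subset)
  have "2 * card \<Psi> = (\<Sum>\<psi>\<in>\<Psi>. card (F \<inter> boundary X \<psi>))" using assms(4) by simp
  also have "\<dots> = (\<Sum>\<psi>\<in>\<Psi>. card {e \<in> F. borders e \<psi>})"
    by (rule sum.cong[OF refl], rule arg_cong[where f = card]) (use assms(3) in \<open>auto simp: boundary_eq\<close>)
  also have "\<dots> = (\<Sum>e\<in>F. card {\<psi> \<in> \<Psi>. borders e \<psi>})"
    by (rule sum_multicount_gen[OF assms(1) finF]) simp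
  also have "\<dots> \<le> (\<Sum>e\<in>F. 2)"
  proof (rule sum_mono)
    fix e assume "e \<in> F"
    then have e: "e \<in> X" using assms(3) by blast
    note two = card_bordering_faces[OF subset_refl e bridgeless[OF e]]
    have "card {\<psi> \<in> \<Psi>. borders e \<psi>} \<le> card {\<psi> \<in> faces crv X. borders e \<psi>}"
      using two(1) assms(2) by (intro card_mono) auto
    then show "card {\<psi> \<in> \<Psi>. borders e \<psi>} \<le> 2" using two(2) by simp
  qed
  finally show ?thesis by simp
qed

lemma face_rounding:
  fixes c x :: "'v set \<Rightarrow> real" and U :: "'e set \<Rightarrow> 'v set"
  assumes \<psi>: "\<psi> \<in> faces crv X" and fin: "finite P" "finite Q"
    and pairs: "\<And>p. p \<in> P \<Longrightarrow> \<exists>u v. p = {u, v} \<and> {u, v} \<subseteq> \<Union>(en ` boundary X \<psi>)"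
    and bonds: "\<And>F. F \<in> Q \<Longrightarrow> bond en X (U F) F"
    and c: "\<forall>p\<in>P. 0 \<le> c p" and x: "\<forall>p\<in>P. 0 \<le> x p"
    and frac: "\<forall>F\<in>Q. 1 \<le> (\<Sum>p | p \<in> P \<and> splits (U F) p. x p)"
  shows "\<exists>S\<subseteq>P. (\<forall>F\<in>Q. \<exists>p\<in>S. splits (U F) p) \<and> (\<Sum>p\<in>S. c p) \<le> 8 * (\<Sum>p\<in>P. c p * x p)"
proof (cases "boundary X \<psi> = {}")
  case True
  have "P = {}"
  proof (rule equals0I)
    fix p assume "p \<in> P"
    from pairs[OF this] show False using True by auto
  qed
  then have "Q = {}" using frac by fastforce
  then show ?thesis using \<open>P = {}\<close> by auto
next
  case False
  let ?N = "\<Union>(en ` boundary X \<psi>)"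
  obtain \<kappa> :: "'v \<Rightarrow> int" where \<kappa>: "\<forall>U F. bond en X U F \<longrightarrow> F \<inter> boundary X \<psi> \<noteq> {} \<longrightarrow>
    (\<exists>a b. \<forall>u\<in>?N. \<forall>v\<in>?N. (u \<in> U \<longleftrightarrow> v \<in> U) \<longleftrightarrow> (\<kappa> u \<in> {a..b} \<longleftrightarrow> \<kappa> v \<in> {a..b}))"
    using bonds_are_intervals_on_face[OF \<psi> False] by (elim exE) (rule that)
  define l where "l p = Min (\<kappa> ` p)" for p
  define r where "r p = Max (\<kappa> ` p)" for p
  have lr: "\<forall>p\<in>P. l p \<le> r p"
  proof
    fix p assume "p \<in> P"
    from pairs[OF this] obtain u v where "p = {u, v}" by (elim exE conjE) (rule that)
    then show "l p \<le> r p" by (simp add: l_def r_def)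
  qed
  have "\<forall>F\<in>Q. \<exists>ab. \<forall>p\<in>P. splits (U F) p \<longleftrightarrow> (l p \<in> {fst ab..snd ab}) \<noteq> (r p \<in> {fst ab..snd ab})"
  proof
    fix F assume F: "F \<in> Q"
    have "{p. p \<in> P \<and> splits (U F) p} \<noteq> {}"
    proof
      assume e: "{p. p \<in> P \<and> splits (U F) p} = {}"
      show False using bspec[OF frac F] unfolding e by simp
    qed
    then obtain p0 where p0: "p0 \<in> P" "splits (U F) p0" by blast
    from pairs[OF p0(1)] obtain u v where uv: "p0 = {u, v}" "{u, v} \<subseteq> ?N"
      by (elim exE conjE) (rule that)
    obtain u' v' where u'v': "u' \<in> p0" "v' \<in> p0" "u' \<in> U F" "v' \<notin> U F"
      using p0(2) unfolding splits_def by blast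
    then have "u' \<in> ?N" "v' \<in> ?N" "u' \<in> U F" "v' \<notin> U F"
      using uv by (auto simp only: subset_iff)
    from split_pair_crosses_boundary[OF \<psi> bonds[OF F] this]
    have "F \<inter> boundary X \<psi> \<noteq> {}" by auto
    from \<kappa>[rule_format, OF bonds[OF F] this] obtain a b where ab: "\<forall>u\<in>?N. \<forall>v\<in>?N.
        (u \<in> U F \<longleftrightarrow> v \<in> U F) \<longleftrightarrow> (\<kappa> u \<in> {a..b} \<longleftrightarrow> \<kappa> v \<in> {a..b})"
      by (elim exE) (rule that)
    have "splits (U F) p \<longleftrightarrow> (l p \<in> {a..b}) \<noteq> (r p \<in> {a..b})" if p: "p \<in> P" for p
    proof -
      from pairs[OF p] obtain u v where uv0: "p = {u, v}" "{u, v} \<subseteq> ?N"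
        by (elim exE conjE) (rule that)
      then have uv: "p = {u, v}" "u \<in> ?N" "v \<in> ?N" by simp_all
      have "splits (U F) p \<longleftrightarrow> (u \<in> U F) \<noteq> (v \<in> U F)" unfolding uv(1) splits_def by auto
      also have "\<dots> \<longleftrightarrow> (\<kappa> u \<in> {a..b}) \<noteq> (\<kappa> v \<in> {a..b})"
        using bspec[OF bspec[OF ab uv(2)] uv(3)] by argo
      also have "\<dots> \<longleftrightarrow> (l p \<in> {a..b}) \<noteq> (r p \<in> {a..b})"
        unfolding uv(1) l_def r_def by (cases "\<kappa> u \<le> \<kappa> v") (auto simp: min_def max_def)
      finally show ?thesis .
    qed
    then show "\<exists>ab. \<forall>p\<in>P. splits (U F) p \<longleftrightarrow> (l p \<in> {fst ab..snd ab}) \<noteq> (r p \<in> {fst ab..snd ab})"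
      by (intro exI[of _ "(a, b)"]) simp
  qed
  from bchoice[OF this] obtain ab where
    ab: "\<forall>F\<in>Q. \<forall>p\<in>P. splits (U F) p \<longleftrightarrow> (l p \<in> {fst (ab F)..snd (ab F)}) \<noteq> (r p \<in> {fst (ab F)..snd (ab F)})" ..
  have eq: "{p. p \<in> P \<and> splits (U F) p} =
      {p \<in> P. (l p \<in> {fst (ab F)..snd (ab F)}) \<noteq> (r p \<in> {fst (ab F)..snd (ab F)})}" if "F \<in> Q" for F
    by (rule Collect_cong) (use bspec[OF ab that] in auto)
  have frac': "\<forall>F\<in>Q. 1 \<le>
      (\<Sum>p | p \<in> P \<and> (l p \<in> {fst (ab F)..snd (ab F)}) \<noteq> (r p \<in> {fst (ab F)..snd (ab F)}). x p)"
  proof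
    fix F assume F: "F \<in> Q"
    show "1 \<le> (\<Sum>p | p \<in> P \<and> (l p \<in> {fst (ab F)..snd (ab F)}) \<noteq> (r p \<in> {fst (ab F)..snd (ab F)}). x p)"
      using bspec[OF frac F] unfolding eq[OF F] .
  qed
  obtain S where S: "S \<subseteq> P"
    "\<forall>F\<in>Q. \<exists>p\<in>S. (l p \<in> {fst (ab F)..snd (ab F)}) \<noteq> (r p \<in> {fst (ab F)..snd (ab F)})"
    "(\<Sum>p\<in>S. c p) \<le> 8 * (\<Sum>p\<in>P. c p * x p)"
    using interval_cut_cover_le_8_fractional[of P Q c x l r "\<lambda>F. fst (ab F)" "\<lambda>F. snd (ab F)",
        OF fin c x lr frac'] by (elim exE conjE) (rule that)
  have "\<exists>p\<in>S. splits (U F) p" if F: "F \<in> Q" for F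
  proof -
    obtain p where p: "p \<in> S" "(l p \<in> {fst (ab F)..snd (ab F)}) \<noteq> (r p \<in> {fst (ab F)..snd (ab F)})"
      using bspec[OF S(2) F] by (elim bexE) (rule that)
    have "p \<in> P" using p(1) S(1) by blast
    from bspec[OF bspec[OF ab F] this] p(2) have "splits (U F) p" by (rule iffD2)
    then show ?thesis using p(1) by (rule bexI)
  qed
  then show ?thesis using S(1,3) by (intro exI[of _ S]) simp
qed

end
end

section \<open>Relevant scenarios are bonds\<close>

lemma reach_delete_edge:
  assumes "reach en A s v"
  shows "reach en (A - {e}) s v \<or>
    (\<exists>a b. en e = {a, b} \<and> reach en (A - {e}) s a \<and> reach en (A - {e}) b v)"
  using assms
proof (induction rule: reach_induct)
  case refl
  then show ?case by simp
next
  case (step x y e')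
  show ?case
  proof (cases "e' = e")
    case False
    then have "reach en (A - {e}) x y" using step.hyps by (intro reach_edge[of e' _ en x y]) auto
    then show ?thesis using step.IH reach_trans by metis
  next
    case True
    then have e: "en e = {x, y}" using step.hyps(3) by simp
    from step.IH show ?thesis
    proof
      assume "reach en (A - {e}) s x"
      then show ?thesis using e by (intro disjI2 exI[of _ x] exI[of _ y]) simp
    next
      assume "\<exists>a b. en e = {a, b} \<and> reach en (A - {e}) s a \<and> reach en (A - {e}) b x"
      then obtain a b where ab: "en e = {a, b}" "reach en (A - {e}) s a" by blast
      then have "a = x \<or> a = y" using e by auto
      then show ?thesis
      proof
        assume "a = x"
        then show ?thesis using e ab(2) by (intro disjI2 exI[of _ x] exI[of _ y]) simp
      next
        assume "a = y"
        then show ?thesis using ab(2) by simp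
      qed
    qed
  qed
qed

lemma minimal_cut_edge_ends:
  assumes "e \<in> F" "e \<in> X" "reach en (X - (F - {e})) s t" "\<not> reach en (X - F) s t"
  shows "\<exists>a b. en e = {a, b} \<and> reach en (X - F) s a \<and> reach en (X - F) b t"
proof -
  have "X - (F - {e}) - {e} = X - F" using assms(1) by blast
  then show ?thesis using reach_delete_edge[OF assms(3), of e] assms(4) by simp
qed

text \<open>No component of the graph without \<open>F\<close> avoids both \<open>s\<close> and \<open>t\<close>: a walk from \<open>s\<close> in \<open>X\<close> crosses \<open>F\<close> only
  between these two components.\<close>

lemma minimal_cut_two_sides:
  assumes cut: "\<And>e. e \<in> F \<Longrightarrow> \<exists>a b. en e = {a, b} \<and> reach en (X - F) s a \<and> reach en (X - F) b t"
    and "reach en X s v"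
  shows "reach en (X - F) s v \<or> reach en (X - F) v t"
  using assms(2)
proof (induction rule: reach_induct)
  case refl
  then show ?case by simp
next
  case (step x y e)
  show ?case
  proof (cases "e \<in> F")
    case True
    then obtain a b where "en e = {a, b}" "reach en (X - F) s a" "reach en (X - F) b t"
      using cut by blast
    then show ?thesis using step.hyps(3) by (auto simp: doubleton_eq_iff)
  next
    case False
    then have "e \<in> X - F" using step.hyps(2) by blast
    from reach_edge[of e _ en x y, OF this step.hyps(3)] have xy: "reach en (X - F) x y" .
    from step.IH show ?thesis
    proof
      assume "reach en (X - F) s x"
      from reach_trans[OF this xy] show ?thesis ..
    next
      assume "reach en (X - F) x t"
      from reach_trans[OF reach_sym[OF xy] this] show ?thesis ..
    qed
  qed
qed

lemma minimal_cut_bond: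
  assumes FX: "F \<subseteq> X" and two: "\<And>e. e \<in> X \<Longrightarrow> card (en e) = 2"
    and sep: "\<not> reach en (X - F) s t"
    and cut: "\<And>e. e \<in> F \<Longrightarrow> \<exists>a b. en e = {a, b} \<and> reach en (X - F) s a \<and> reach en (X - F) b t"
    and conn: "\<And>v. v \<in> \<Union>(en ` X) \<Longrightarrow> reach en X s v"
  shows "bond en X {v. reach en (X - F) s v} F"
proof -
  let ?U = "{v. reach en (X - F) s v}"
  have apart: False if "reach en (X - F) s v" "reach en (X - F) v t" for v
    using sep reach_trans[OF that] by blast
  have "e \<in> F \<longleftrightarrow> e \<in> cut en X ?U" if e: "e \<in> X" for e
  proof
    assume "e \<in> F"
    then obtain a b where ab: "en e = {a, b}" "reach en (X - F) s a" "reach en (X - F) b t"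
      using cut by blast
    then have "b \<notin> ?U" using apart[of b] by blast
    then show "e \<in> cut en X ?U" using e ab by (auto simp: cut_def)
  next
    assume "e \<in> cut en X ?U"
    then obtain c d where cd: "c \<in> en e" "d \<in> en e" "reach en (X - F) s c" "\<not> reach en (X - F) s d"
      by (auto simp: cut_def)
    show "e \<in> F"
    proof (rule ccontr)
      assume "e \<notin> F"
      obtain c' d' where "en e = {c', d'}" using two[OF e] by (meson card_2_iff)
      then have "en e = {c, d}" using cd by auto
      moreover have "e \<in> X - F" using e \<open>e \<notin> F\<close> by blast
      ultimately have "reach en (X - F) c d" by (intro reach_edge)
      from reach_trans[OF cd(3) this] cd(4) show False by simp
    qed
  qed
  then have "F = cut en X ?U" using FX by (auto simp: cut_def)
  moreover have "reach en (X - F) u v"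
    if uv: "u \<in> \<Union>(en ` X)" "v \<in> \<Union>(en ` X)" "u \<in> ?U \<longleftrightarrow> v \<in> ?U" for u v
  proof (cases "u \<in> ?U")
    case True
    then have "reach en (X - F) s u" "reach en (X - F) s v" using uv(3) by simp_all
    then show ?thesis using reach_trans[OF reach_sym] by metis
  next
    case False
    have "reach en (X - F) u t" "reach en (X - F) v t"
      using minimal_cut_two_sides[OF cut conn[OF uv(1)]] minimal_cut_two_sides[OF cut conn[OF uv(2)]]
        False uv(3) by auto
    then show ?thesis using reach_trans[OF _ reach_sym] by metis
  qed
  ultimately show ?thesis unfolding bond_def by (intro conjI ballI impI)
qed

lemma plane_graph_of_embedding:
  assumes G: "multigraph G" and emb: "planar_embedding G pos crv" and X: "X \<subseteq> edges G"
    and two: "\<And>e. e \<in> X \<Longrightarrow> card (ends G e) = 2"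
  shows "plane_graph X (ends G) pos crv"
proof
  have verts: "ends G e \<subseteq> verts G" if "e \<in> X" for e using G X that by (auto simp: multigraph_def)
  have inj: "inj_on pos (verts G)" using emb by (simp add: planar_embedding_def)
  have edge: "simple_path (crv e)" "{pathstart (crv e), pathfinish (crv e)} = pos ` ends G e"
    if "e \<in> X" for e using emb X that unfolding planar_embedding_def by auto
  show "finite X" using G X finite_subset by (auto simp: multigraph_def)
  show "card (ends G e) = 2" if "e \<in> X" for e using two[OF that] .
  show "{pathstart (crv e), pathfinish (crv e)} = pos ` ends G e" if "e \<in> X" for e
    using edge(2)[OF that] .
  show "arc (crv e)" if e: "e \<in> X" for e
  proof -
    have "card (pos ` ends G e) = 2"
      using card_image[OF inj_on_subset[OF inj verts[OF e]]] two[OF e] by simp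
    then have "pathstart (crv e) \<noteq> pathfinish (crv e)"
      unfolding edge(2)[OF e, symmetric] by auto
    then show ?thesis using edge(1)[OF e] by (simp add: arc_simple_path)
  qed
  show "inj_on pos (\<Union>e\<in>X. ends G e)" by (rule inj_on_subset[OF inj]) (use verts in blast)
  show "path_image (crv e) \<inter> path_image (crv e') = pos ` (ends G e \<inter> ends G e')"
    if "e \<in> X" "e' \<in> X" "e \<noteq> e'" for e e'
    using emb X that unfolding planar_embedding_def by blast
qed

text \<open>Leaving out an edge turns a relevant scenario into one of size \<open>i - 1\<close>, against which \<open>X\<close> is feasible. The
  \<open>s\<close>-\<open>t\<close> path that survives has to use that edge, which thus joins the two sides.\<close>

lemma relevant_minimal:
  assumes G: "multigraph G" and s: "s \<in> verts G" and i: "2 \<le> i"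
    and X: "feasible G m Fs s t (i - 1) X" and F: "F \<in> relevant G m Fs s t i X"
  shows "F \<subseteq> X" "card F = i" "\<not> reach (ends G) (X - F) s t"
    and "\<And>e. e \<in> F \<Longrightarrow>
      \<exists>a b. ends G e = {a, b} \<and> reach (ends G) (X - F) s a \<and> reach (ends G) (X - F) b t"
proof -
  have XE: "X \<subseteq> edges G" using X by (simp add: feasible_def)
  have j: "joined G (X - K) s t \<longleftrightarrow> reach (ends G) (X - K) s t" for K
    by (rule joined_iff_reach[OF G _ s]) (use XE in blast)
  have "1 \<le> i" using i by simp
  from relevant_subset_card[OF G this X F] show FX: "F \<subseteq> X" and card: "card F = i" .
  show sep: "\<not> reach (ends G) (X - F) s t" using F j[of F] by (simp add: relevant_def)
  fix e assume e: "e \<in> F"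
  have "finite F" using card i by (intro card_ge_0_finite) simp
  then have "card (F - {e}) \<le> i - 1" using card e by simp
  moreover have "F - {e} \<subseteq> edges G" "\<exists>j\<in>{1..m}. F - {e} \<subseteq> Fs j"
    using F by (auto simp: relevant_def scenarios_def)
  ultimately have "F - {e} \<in> scenarios G m Fs (i - 1)" by (simp add: scenarios_def)
  then have "joined G (X - (F - {e})) s t" using X by (simp add: feasible_def)
  then have "reach (ends G) (X - (F - {e})) s t" using j by simp
  then show "\<exists>a b. ends G e = {a, b} \<and> reach (ends G) (X - F) s a \<and> reach (ends G) (X - F) b t"
    using minimal_cut_edge_ends[OF e _ _ sep] FX e by blast
qed

lemma link_length_nonneg: "0 \<le> link_length w L p"
  by (simp add: link_length_def sum_nonneg)

section \<open>Rounding a clean solution\<close>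

theorem lemma11:
  fixes G :: "('v, 'e) mgraph"
    and pos :: "'v \<Rightarrow> complex" and crv :: "'e \<Rightarrow> real \<Rightarrow> complex"
    and w :: "'e \<Rightarrow> nat" and s t :: 'v
    and m :: nat and Fs :: "nat \<Rightarrow> 'e set" and i :: nat and X :: "'e set"
    and L :: "'v set \<Rightarrow> 'e set" and x :: "'v set \<Rightarrow> real" and \<Omega> :: "'e set set"
  assumes "multigraph G" and "planar_embedding G pos crv"
    and "s \<in> verts G" and "t \<in> verts G"
    and "m \<ge> 1" and "\<forall>j\<in>{1..m}. Fs j \<subseteq> edges G"
    and "i \<in> {2..max_failure m Fs}"
    and "feasible G m Fs s t (i - 1) X"
    and "\<Omega> = relevant G m Fs s t i X"
    and "\<forall>e\<in>X. \<exists>F\<in>\<Omega>. e \<in> F"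
    and "is_link_system G w X L"
    and "lp_feasible G s t X \<Omega> x"
    and "clean G pos crv X L x"
  shows "\<exists>S \<subseteq> link_pairs G X.
           (\<forall>F\<in>\<Omega>. \<exists>p\<in>S. covers G s t X p F) \<and>
           (\<Sum>p\<in>S. link_length w L p) \<le> 8 * real i * lp_cost G w X L x"
proof -
  let ?en = "ends G"
  have XE: "X \<subseteq> edges G" using assms(8) by (simp add: feasible_def)
  have i2: "2 \<le> i" using assms(7) by simp
  have rel: "F \<subseteq> X" "card F = i" "\<not> reach ?en (X - F) s t"
    "\<And>e. e \<in> F \<Longrightarrow> \<exists>a b. ?en e = {a, b} \<and> reach ?en (X - F) s a \<and> reach ?en (X - F) b t"
    if F: "F \<in> \<Omega>" for F
    using relevant_minimal[OF assms(1,3) i2 assms(8)] F assms(9) by auto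
  have X_ends: "card (?en e) = 2 \<and> (\<forall>v\<in>?en e. reach ?en X s v)" if e: "e \<in> X" for e
  proof -
    obtain F where F: "F \<in> \<Omega>" "e \<in> F" using assms(10) e by blast
    obtain a b where ab: "?en e = {a, b}" "reach ?en (X - F) s a" "reach ?en (X - F) b t"
      using rel(4)[OF F] by (elim exE conjE) (rule that)
    have "a \<noteq> b" using rel(3)[OF F(1)] reach_trans[OF ab(2)] ab(3) by blast
    have sa: "reach ?en X s a" by (rule reach_mono[OF _ ab(2)]) blast
    moreover have "reach ?en X s b" by (rule reach_trans[OF sa reach_edge[of e _ ?en a b, OF e ab(1)]])
    ultimately show ?thesis using ab(1) \<open>a \<noteq> b\<close> by simp
  qed
  define N where "N = \<Union>(?en ` X)"
  have N: "incident_nodes G X = N" by (simp add: N_def incident_nodes_def)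
  have reach_s: "reach ?en X s v" if "v \<in> N" for v using X_ends that by (auto simp: N_def)
  (* The side of s; by minimality of F the rest of the nodes form the side of t. *)
  define U where "U F = {v. reach ?en (X - F) s v}" for F
  have bond: "bond ?en X (U F) F" if F: "F \<in> \<Omega>" for F
    unfolding U_def
    by (rule minimal_cut_bond[OF rel(1)[OF F] _ rel(3)[OF F] rel(4)[OF F]])
       (use X_ends reach_s in \<open>auto simp: N_def\<close>)
  interpret plane_graph X ?en pos crv
    by (rule plane_graph_of_embedding[OF assms(1,2) XE]) (use X_ends in blast)
  have cyc: "on_cycle ?en X e" if e: "e \<in> X" for e
  proof -
    obtain F where F: "F \<in> \<Omega>" "e \<in> F" using assms(10) e by blast
    have "\<not> F \<subseteq> {e}"
    proof
      assume "F \<subseteq> {e}"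
      then have "card F \<le> card {e}" by (intro card_mono) simp_all
      then show False using rel(2)[OF F(1)] i2 by simp
    qed
    then obtain e2 where e2: "e2 \<in> F" "e2 \<noteq> e" by blast
    then have e2X: "e2 \<in> X" using rel(1)[OF F(1)] by blast
    show ?thesis
      by (rule bond_edge_on_cycle[OF bond[OF F(1)] F(2) e2 card_en[OF e] card_en[OF e2X] _ e2X]) blast
  qed
  have reach_N: "reach ?en X u v" if "u \<in> \<Union>(?en ` X)" "v \<in> \<Union>(?en ` X)" for u v
    using reach_trans[OF reach_sym[OF reach_s] reach_s] that by (simp add: N_def)
  have side_s: "side G X F s = N \<inter> U F" for F
    using joined_iff_reach[OF assms(1) _ assms(3), of "X - F"] XE by (auto simp: side_def N U_def)
  have side_t: "side G X F t = N - U F" if F: "F \<in> \<Omega>" for F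
  proof -
    have "joined G (X - F) t v \<longleftrightarrow> v \<notin> U F" if v: "v \<in> N" for v
    proof -
      have "joined G (X - F) t v \<longleftrightarrow> reach ?en (X - F) v t"
        using joined_iff_reach[OF assms(1) _ assms(4), of "X - F"] XE
          reach_sym[of ?en "X - F" t v] reach_sym[of ?en "X - F" v t] by blast
      moreover have "reach ?en (X - F) s v \<or> reach ?en (X - F) v t"
        by (rule minimal_cut_two_sides[OF rel(4)[OF F] reach_s[OF v]])
      moreover have "\<not> (reach ?en (X - F) s v \<and> reach ?en (X - F) v t)"
        using rel(3)[OF F] reach_trans[of ?en "X - F" s v t] by blast
      ultimately show ?thesis unfolding U_def by blast
    qed
    then show ?thesis by (auto simp: side_def N)
  qed
  have pairsN: "\<exists>u v. p = {u, v} \<and> u \<in> N \<and> v \<in> N" if "p \<in> link_pairs G X" for p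
    using that unfolding link_pairs_def N by blast
  have covers: "covers G s t X p F \<longleftrightarrow> splits (U F) p" if F: "F \<in> \<Omega>" and p: "p \<in> link_pairs G X" for F p
  proof -
    obtain u v where uv: "p = {u, v}" "u \<in> N" "v \<in> N" using pairsN[OF p] by (elim exE conjE) (rule that)
    show ?thesis
    proof
      assume "covers G s t X p F"
      then obtain a b where "p = {a, b}" "a \<in> U F" "b \<notin> U F"
        unfolding covers_def side_s side_t[OF F] by blast
      then show "splits (U F) p" by (auto simp: splits_def)
    next
      assume "splits (U F) p"
      then have "u \<in> U F \<and> v \<notin> U F \<or> v \<in> U F \<and> u \<notin> U F" unfolding splits_def uv(1) by auto
      then show "covers G s t X p F"
        unfolding covers_def side_s side_t[OF F] using uv
        by (elim disjE) (intro exI[of _ u] exI[of _ v], simp, intro exI[of _ v] exI[of _ u], auto)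
    qed
  qed
  have finN: "finite N" unfolding N_def using finite_X card_en by (auto intro!: card_ge_0_finite)
  have "link_pairs G X \<subseteq> Pow N" using pairsN by fastforce
  then have finLP: "finite (link_pairs G X)" using finite_Pow_iff finN finite_subset by metis
  have "\<Omega> \<subseteq> Pow X" using rel(1) by blast
  then have fin\<Omega>: "finite \<Omega>" using finite_Pow_iff finite_X finite_subset by metis
  (* As x is clean, the other links contribute neither to the cost nor to any covering constraint. *)
  define P where "P = {p \<in> link_pairs G X. typed pos crv X L p}"
  have PL: "P \<subseteq> link_pairs G X" and finP: "finite P" using finLP by (auto simp: P_def)
  (* A link may have several types; each link is charged to one of them. *)
  define face where "face p = (SOME \<psi>. \<psi> \<in> faces crv X \<and> of_type pos crv L \<psi> p)" for p
  have face: "face p \<in> faces crv X \<and> of_type pos crv L (face p) p" if "p \<in> P" for p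
    unfolding face_def by (rule someI_ex) (use that in \<open>auto simp: P_def typed_def\<close>)
  have on_face: "\<exists>u v. p = {u, v} \<and> {u, v} \<subseteq> \<Union>(?en ` boundary X (face p))" if p: "p \<in> P" for p
  proof -
    have "p \<in> link_pairs G X" using p PL by blast
    from pairsN[OF this] obtain u v where uv: "p = {u, v}" "u \<in> N" "v \<in> N"
      by (elim exE conjE) (rule that)
    have "pos u \<in> frontier (face p)" "pos v \<in> frontier (face p)"
      using face[OF p] uv(1) by (auto simp: of_type_def)
    then have "u \<in> \<Union>(?en ` boundary X (face p))" "v \<in> \<Union>(?en ` boundary X (face p))"
      using frontier_node_on_boundary[OF cyc reach_N] face[OF p] uv(2,3) by (simp_all add: N_def)
    then show ?thesis using uv(1) by (intro exI[of _ u] exI[of _ v]) simp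
  qed
  have x0: "\<forall>p\<in>P. 0 \<le> x p" using assms(12) PL unfolding lp_feasible_def by blast
  have frac: "\<forall>F\<in>\<Omega>. 1 \<le> (\<Sum>p | p \<in> P \<and> splits (U F) p. x p)"
  proof
    fix F assume F: "F \<in> \<Omega>"
    have "1 \<le> (\<Sum>p\<in>cover G s t X F. x p)" using assms(12) F unfolding lp_feasible_def by blast
    also have "\<dots> = (\<Sum>p | p \<in> P \<and> splits (U F) p. x p)"
    proof (rule sum.mono_neutral_right)
      show "finite (cover G s t X F)" using finLP by (simp add: cover_def)
      show "{p. p \<in> P \<and> splits (U F) p} \<subseteq> cover G s t X F"
        using covers[OF F] PL by (auto simp: cover_def)
      show "\<forall>p\<in>cover G s t X F - {p. p \<in> P \<and> splits (U F) p}. x p = 0"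
        using covers[OF F] assms(13) by (auto simp: cover_def P_def clean_def)
    qed
    finally show "1 \<le> (\<Sum>p | p \<in> P \<and> splits (U F) p. x p)" .
  qed
  have few: "\<forall>F\<in>\<Omega>. card (face ` {p \<in> P. splits (U F) p}) \<le> i"
  proof
    fix F assume F: "F \<in> \<Omega>"
    have "card (face ` {p \<in> P. splits (U F) p}) \<le> card F"
    proof (rule card_crossed_faces[OF cyc reach_N])
      show "finite (face ` {p \<in> P. splits (U F) p})" using finP by simp
      show "face ` {p \<in> P. splits (U F) p} \<subseteq> faces crv X" using face by auto
      show "F \<subseteq> X" using rel(1)[OF F] .
      show "\<forall>\<psi>\<in>face ` {p \<in> P. splits (U F) p}. card (F \<inter> boundary X \<psi>) = 2"
      proof
        fix \<psi> assume "\<psi> \<in> face ` {p \<in> P. splits (U F) p}"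
        then obtain p where p: "p \<in> P" "splits (U F) p" "\<psi> = face p" by blast
        obtain a b where ab: "a \<in> p" "b \<in> p" "a \<in> U F" "b \<notin> U F" using p(2) unfolding splits_def by blast
        from on_face[OF p(1)] have "p \<subseteq> \<Union>(?en ` boundary X \<psi>)" unfolding p(3) by (elim exE conjE) simp
        then have "a \<in> \<Union>(?en ` boundary X \<psi>)" "b \<in> \<Union>(?en ` boundary X \<psi>)" using ab by auto
        from split_pair_crosses_boundary[OF cyc reach_N _ bond[OF F] this ab(3,4)]
        show "card (F \<inter> boundary X \<psi>) = 2" using face[OF p(1)] p(3) by simp
      qed
    qed
    then show "card (face ` {p \<in> P. splits (U F) p}) \<le> i" using rel(2)[OF F] by simp
  qed
  have round: "\<exists>S\<subseteq>{p \<in> P. face p = \<psi>}. (\<forall>F\<in>R. \<exists>p\<in>S. splits (U F) p) \<and>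
      (\<Sum>p\<in>S. link_length w L p) \<le> 8 * (\<Sum>p | p \<in> P \<and> face p = \<psi>. link_length w L p * y p)"
    if R: "R \<subseteq> \<Omega>" and \<psi>: "\<psi> \<in> face ` P" and y: "\<forall>p\<in>P. 0 \<le> y p"
      and fr: "\<forall>F\<in>R. 1 \<le> (\<Sum>p | p \<in> {p \<in> P. face p = \<psi>} \<and> splits (U F) p. y p)" for R \<psi> y
  proof (rule face_rounding[OF cyc reach_N])
    show "\<psi> \<in> faces crv X" using face \<psi> by auto
    show "finite {p \<in> P. face p = \<psi>}" using finP by simp
    show "finite R" using finite_subset[OF R fin\<Omega>] .
    show "\<exists>u v. p = {u, v} \<and> {u, v} \<subseteq> \<Union>(?en ` boundary X \<psi>)" if "p \<in> {p \<in> P. face p = \<psi>}" for p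
      using on_face[of p] that by simp
    show "bond ?en X (U F) F" if "F \<in> R" for F using bond R that by blast
    show "\<forall>p\<in>{p \<in> P. face p = \<psi>}. 0 \<le> link_length w L p" by (simp add: link_length_nonneg)
    show "\<forall>p\<in>{p \<in> P. face p = \<psi>}. 0 \<le> y p" using y by simp
    show "\<forall>F\<in>R. 1 \<le> (\<Sum>p | p \<in> {p \<in> P. face p = \<psi>} \<and> splits (U F) p. y p)" using fr .
  qed
  have "\<exists>S\<subseteq>P. (\<forall>F\<in>\<Omega>. \<exists>p\<in>S. splits (U F) p) \<and>
      (\<Sum>p\<in>S. link_length w L p) \<le> 8 * real i * (\<Sum>p\<in>P. link_length w L p * x p)"
    by (rule rounding_by_classes[of P \<Omega> x "\<lambda>p F. splits (U F) p" face i "link_length w L" 8,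
          OF finP fin\<Omega> x0 frac few]) (rule round)
  then obtain S where S: "S \<subseteq> P" "\<forall>F\<in>\<Omega>. \<exists>p\<in>S. splits (U F) p"
    "(\<Sum>p\<in>S. link_length w L p) \<le> 8 * real i * (\<Sum>p\<in>P. link_length w L p * x p)"
    by (elim exE conjE) (rule that)
  have "(\<Sum>p\<in>P. link_length w L p * x p) = lp_cost G w X L x"
    unfolding lp_cost_def
  proof (rule sum.mono_neutral_left[OF finLP PL])
    show "\<forall>p\<in>link_pairs G X - P. link_length w L p * x p = 0"
      using assms(13) by (simp add: P_def clean_def)
  qed
  moreover have "\<exists>p\<in>S. covers G s t X p F" if F: "F \<in> \<Omega>" for F
  proof -
    obtain p where p: "p \<in> S" "splits (U F) p" using bspec[OF S(2) F] by (elim bexE) (rule that)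
    have "p \<in> link_pairs G X" using p(1) S(1) PL by blast
    from covers[OF F this] p show ?thesis by blast
  qed
  moreover have "S \<subseteq> link_pairs G X" using S(1) PL by (rule subset_trans)
  ultimately show ?thesis using S(3) by (intro exI[of _ S] conjI ballI) simp_all
qed

end
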